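(* Let $f\colon P\twoheadrightarrow Q$ be an operator-reduced quandle homomorphism such that $\mathrm{Inn}_{\mathrm{rel}}(f)$ is a finite group. If $Q$ is nilpotent, then both $f$ and $P$ are nilpotent. More precisely, if $Q$ is $r$-nilpotent and $\mathrm{Inn}_{\mathrm{rel}}(f)$ has an $\mathrm{Inn}(P)$-chief series of length $m$, then $f$ is $m$-nilpotent and $P$ is $(m+r)$-nilpotent.
   Context: A quandle is a set $Q$ with a map $s_x\colon Q\to Q$ for each $x\in Q$ such that, for all $x,y\in Q$, $s_x(x)=x$, $s_x$ is bijective, and $s_x\circ s_y=s_{s_x(y)}\circ s_x$. A quandle homomorphism is a map $f\colon P\to Q$ with $f\circ s_x=s_{f(x)}\circ f$ for all $x\in P$. The inner automorphism group $\mathrm{Inn}(Q)$ is the subgroup of $\mathrm{Aut}(Q)$ generated by all $s_x$. For a surjective quandle homomorphism $f\colon P\twoheadrightarrow Q$ there is a unique surjective group homomorphism $f_*\colon\mathrm{Inn}(P)\to\mathrm{Inn}(Q)$ with $f_*(s_x)=s_{f(x)}$; put $\mathrm{Inn}_{\mathrm{rel}}(f)=\mathrm{Ker}(f_* )$. For subgroups $A,B$ of a group, $[A,B]$ is the subgroup generated by all $[a,b]=aba^{-1}b^{-1}$. For $N\trianglelefteq G$ put $\Gamma_0(G,N)=N$, $\Gamma_{i+1}(G,N)=[G,\Gamma_i(G,N)]$, and $\Gamma_i(G)=\Gamma_i(G,G)$ (lower central series starting in degree $0$). A quandle $Q$ is $c$-nilpotent if $\Gamma_c(\mathrm{Inn}(Q))=1$,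 and nilpotent if this holds for some integer $c\geq0$. A surjective homomorphism $f\colon P\twoheadrightarrow Q$ is $c$-nilpotent if $\Gamma_c(\mathrm{Inn}(P),\mathrm{Inn}_{\mathrm{rel}}(f))=1$, and nilpotent if this holds for some integer $c\ge0$. It is operator-reduced if it is surjective and $s_xs_{\varphi(x)}=s_{\varphi(x)}s_x$ for every $x\in P$ and every $\varphi\in\mathrm{Inn}_{\mathrm{rel}}(f)$. For $N\trianglelefteq G$, a $G$-chief series of $N$ of length $m$ is a chain $1=N_0<N_1<\cdots<N_m=N$ of normal subgroups of $G$ such that $N_i/N_{i-1}$ is a nontrivial minimal normal subgroup of $G/N_{i-1}$ for every $1\le i\le m$. *)

theory Defs
  imports "HOL-Algebra.Algebra"
begin

section \<open>Quandles and inner automorphisms\<close>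

record 'a quandle_struct = "'a partial_object" +
  qsym :: "'a \<Rightarrow> 'a \<Rightarrow> 'a"

locale quandle =
  fixes Q :: "('a, 'b) quandle_struct_scheme" (structure)
  assumes sym_idem: "x \<in> carrier Q \<Longrightarrow> qsym Q x x = x"
    and sym_bij: "x \<in> carrier Q \<Longrightarrow> bij_betw (qsym Q x) (carrier Q) (carrier Q)"
    and sym_distrib: "\<lbrakk>x \<in> carrier Q; y \<in> carrier Q; z \<in> carrier Q\<rbrakk> \<Longrightarrow>
      qsym Q x (qsym Q y z) = qsym Q (qsym Q x y) (qsym Q x z)"

definition quandle_hom ::
    "('a, 'm) quandle_struct_scheme \<Rightarrow> ('b, 'n) quandle_struct_scheme \<Rightarrow> ('a \<Rightarrow> 'b) set" where
  "quandle_hom P Q =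
    {f \<in> carrier P \<rightarrow> carrier Q.
      \<forall>x\<in>carrier P. \<forall>y\<in>carrier P. f (qsym P x y) = qsym Q (f x) (f y)}"

definition quandle_epi ::
    "('a, 'm) quandle_struct_scheme \<Rightarrow> ('b, 'n) quandle_struct_scheme \<Rightarrow> ('a \<Rightarrow> 'b) set" where
  "quandle_epi P Q = {f \<in> quandle_hom P Q. f ` carrier P = carrier Q}"

text \<open>As in \<^const>\<open>AutoGroup\<close>, automorphisms are represented by functions that are
  undefined outside the carrier; hence the restriction in \<open>symm\<close> below.\<close>

definition quandle_Aut :: "('a, 'm) quandle_struct_scheme \<Rightarrow> ('a \<Rightarrow> 'a) monoid" where
  "quandle_Aut Q =
    BijGroup (carrier Q) \<lparr>carrier := quandle_hom Q Q \<inter> Bij (carrier Q)\<rparr>"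

definition symm :: "('a, 'm) quandle_struct_scheme \<Rightarrow> 'a \<Rightarrow> 'a \<Rightarrow> 'a" where
  "symm Q x = restrict (qsym Q x) (carrier Q)"

definition Inn :: "('a, 'm) quandle_struct_scheme \<Rightarrow> ('a \<Rightarrow> 'a) monoid" where
  "Inn Q = subgroup_generated (quandle_Aut Q) (symm Q ` carrier Q)"

text \<open>The induced map \<open>f\<^sub>*\<close>. Extensionality only fixes its values outside the group;
  existence and uniqueness are proved in \<open>ex1_Inn_map\<close>.\<close>

definition is_Inn_map ::
    "('a, 'm) quandle_struct_scheme \<Rightarrow> ('b, 'n) quandle_struct_scheme \<Rightarrow> ('a \<Rightarrow> 'b)
      \<Rightarrow> (('a \<Rightarrow> 'a) \<Rightarrow> 'b \<Rightarrow> 'b) \<Rightarrow> bool" where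
  "is_Inn_map P Q f h \<longleftrightarrow>
    h \<in> epi (Inn P) (Inn Q) \<and> h \<in> extensional (carrier (Inn P)) \<and>
    (\<forall>x\<in>carrier P. h (symm P x) = symm Q (f x))"

definition Inn_map ::
    "('a, 'm) quandle_struct_scheme \<Rightarrow> ('b, 'n) quandle_struct_scheme \<Rightarrow> ('a \<Rightarrow> 'b)
      \<Rightarrow> ('a \<Rightarrow> 'a) \<Rightarrow> 'b \<Rightarrow> 'b" where
  "Inn_map P Q f = (THE h. is_Inn_map P Q f h)"

definition Inn_rel ::
    "('a, 'm) quandle_struct_scheme \<Rightarrow> ('b, 'n) quandle_struct_scheme \<Rightarrow> ('a \<Rightarrow> 'b)
      \<Rightarrow> ('a \<Rightarrow> 'a) set" where
  "Inn_rel P Q f = kernel (Inn P) (Inn Q) (Inn_map P Q f)"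

definition operator_reduced ::
    "('a, 'm) quandle_struct_scheme \<Rightarrow> ('b, 'n) quandle_struct_scheme \<Rightarrow> ('a \<Rightarrow> 'b) \<Rightarrow> bool" where
  "operator_reduced P Q f \<longleftrightarrow>
    f \<in> quandle_epi P Q \<and>
    (\<forall>x\<in>carrier P. \<forall>\<phi>\<in>Inn_rel P Q f.
      symm P x \<otimes>\<^bsub>Inn P\<^esub> symm P (\<phi> x) = symm P (\<phi> x) \<otimes>\<^bsub>Inn P\<^esub> symm P x)"


section \<open>Nilpotency\<close>

definition commutator_subgroup :: "('a, 'm) monoid_scheme \<Rightarrow> 'a set \<Rightarrow> 'a set \<Rightarrow> 'a set" where
  "commutator_subgroup G A B =
    generate G {a \<otimes>\<^bsub>G\<^esub> b \<otimes>\<^bsub>G\<^esub> inv\<^bsub>G\<^esub> a \<otimes>\<^bsub>G\<^esub> inv\<^bsub>G\<^esub> b | a b. a \<in> A \<and> b \<in> B}"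

primrec rel_lower_central :: "('a, 'm) monoid_scheme \<Rightarrow> 'a set \<Rightarrow> nat \<Rightarrow> 'a set" where
  "rel_lower_central G N 0 = N"
| "rel_lower_central G N (Suc i) = commutator_subgroup G (carrier G) (rel_lower_central G N i)"

abbreviation lower_central :: "('a, 'm) monoid_scheme \<Rightarrow> nat \<Rightarrow> 'a set" where
  "lower_central G \<equiv> rel_lower_central G (carrier G)"

definition c_nilpotent :: "nat \<Rightarrow> ('a, 'm) quandle_struct_scheme \<Rightarrow> bool" where
  "c_nilpotent c Q \<longleftrightarrow> lower_central (Inn Q) c = {\<one>\<^bsub>Inn Q\<^esub>}"

definition nilpotent :: "('a, 'm) quandle_struct_scheme \<Rightarrow> bool" where
  "nilpotent Q \<longleftrightarrow> (\<exists>c. c_nilpotent c Q)"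

definition c_nilpotent_epi ::
    "nat \<Rightarrow> ('a, 'm) quandle_struct_scheme \<Rightarrow> ('b, 'n) quandle_struct_scheme \<Rightarrow> ('a \<Rightarrow> 'b) \<Rightarrow> bool" where
  "c_nilpotent_epi c P Q f \<longleftrightarrow>
    f \<in> quandle_epi P Q \<and> rel_lower_central (Inn P) (Inn_rel P Q f) c = {\<one>\<^bsub>Inn P\<^esub>}"

definition nilpotent_epi ::
    "('a, 'm) quandle_struct_scheme \<Rightarrow> ('b, 'n) quandle_struct_scheme \<Rightarrow> ('a \<Rightarrow> 'b) \<Rightarrow> bool" where
  "nilpotent_epi P Q f \<longleftrightarrow> (\<exists>c. c_nilpotent_epi c P Q f)"


section \<open>Chief series\<close>

definition minimal_normal :: "'a set \<Rightarrow> ('a, 'm) monoid_scheme \<Rightarrow> bool" where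
  "minimal_normal M G \<longleftrightarrow>
    M \<lhd> G \<and> M \<noteq> {\<one>\<^bsub>G\<^esub>} \<and> (\<forall>K. K \<lhd> G \<longrightarrow> K \<subseteq> M \<longrightarrow> K = {\<one>\<^bsub>G\<^esub>} \<or> K = M)"

text \<open>A \<open>G\<close>-chief series \<open>S 0 \<subset> \<dots> \<subset> S m\<close> of \<open>N\<close>; the values of \<open>S\<close> beyond \<open>m\<close>
  are irrelevant. The carrier of \<open>G\<lparr>carrier := S (Suc i)\<rparr> Mod S i\<close> is the set of
  cosets of \<open>S i\<close> by elements of \<open>S (Suc i)\<close>, viewed as a subset of \<open>G Mod S i\<close>.\<close>

definition chief_series :: "('a, 'm) monoid_scheme \<Rightarrow> 'a set \<Rightarrow> nat \<Rightarrow> (nat \<Rightarrow> 'a set) \<Rightarrow> bool" where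
  "chief_series G N m S \<longleftrightarrow>
    S 0 = {\<one>\<^bsub>G\<^esub>} \<and> S m = N \<and>
    (\<forall>i\<le>m. S i \<lhd> G) \<and>
    (\<forall>i<m. S i \<subset> S (Suc i) \<and>
      minimal_normal (carrier (G\<lparr>carrier := S (Suc i)\<rparr> Mod S i)) (G Mod S i))"


section \<open>Existence and uniqueness of the induced map\<close>

lemma carrier_quandle_Aut: "carrier (quandle_Aut Q) = quandle_hom Q Q \<inter> Bij (carrier Q)"
  by (simp add: quandle_Aut_def)

lemma (in quandle) subgroup_quandle_Aut:
  "subgroup (quandle_hom Q Q \<inter> Bij (carrier Q)) (BijGroup (carrier Q))"
proof (rule group.subgroupI[OF group_BijGroup])
  have cl: "qsym Q a b \<in> carrier Q" if "a \<in> carrier Q" "b \<in> carrier Q" for a b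
    using sym_bij[OF that(1)] that(2) by (auto simp: bij_betw_def)
  show "quandle_hom Q Q \<inter> Bij (carrier Q) \<subseteq> carrier (BijGroup (carrier Q))"
    by (auto simp: BijGroup_def)
  show "quandle_hom Q Q \<inter> Bij (carrier Q) \<noteq> {}"
  proof -
    have "(\<lambda>x\<in>carrier Q. x) \<in> quandle_hom Q Q \<inter> Bij (carrier Q)"
      using id_Bij[of "carrier Q"] cl by (simp add: quandle_hom_def)
    then show ?thesis by blast
  qed
  show "inv\<^bsub>BijGroup (carrier Q)\<^esub> a \<in> quandle_hom Q Q \<inter> Bij (carrier Q)"
    if a: "a \<in> quandle_hom Q Q \<inter> Bij (carrier Q)" for a
  proof -
    have "inv_into (carrier Q) a (qsym Q x y)
        = qsym Q (inv_into (carrier Q) a x) (inv_into (carrier Q) a y)"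
      if "x \<in> carrier Q" "y \<in> carrier Q" for x y
      using Bij_inv_into_lemma[of "carrier Q" a "qsym Q" x y] a that cl
      by (auto simp: quandle_hom_def)
    then show ?thesis
      using a restrict_inv_into_Bij[of a "carrier Q"] cl
      by (auto simp: inv_BijGroup quandle_hom_def Bij_inv_into_mem)
  qed
  show "a \<otimes>\<^bsub>BijGroup (carrier Q)\<^esub> b \<in> quandle_hom Q Q \<inter> Bij (carrier Q)"
    if "a \<in> quandle_hom Q Q \<inter> Bij (carrier Q)" "b \<in> quandle_hom Q Q \<inter> Bij (carrier Q)" for a b
    using that cl compose_Bij[of a "carrier Q" b]
    by (auto simp: BijGroup_def quandle_hom_def compose_def Pi_iff)
qed

lemma (in quandle) group_quandle_Aut: "group (quandle_Aut Q)"
  unfolding quandle_Aut_def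
  by (rule group.subgroup_imp_group[OF group_BijGroup subgroup_quandle_Aut])

lemma (in quandle) group_Inn: "group (Inn Q)"
  unfolding Inn_def by (rule group.group_subgroup_generated[OF group_quandle_Aut])

lemma (in quandle) symm_in_Aut:
  assumes x: "x \<in> carrier Q"
  shows "symm Q x \<in> carrier (quandle_Aut Q)"
proof -
  have cl: "qsym Q a b \<in> carrier Q" if "a \<in> carrier Q" "b \<in> carrier Q" for a b
    using sym_bij[OF that(1)] that(2) by (auto simp: bij_betw_def)
  have "bij_betw (symm Q x) (carrier Q) (carrier Q)"
    unfolding symm_def using sym_bij[OF x] by simp
  then have "symm Q x \<in> Bij (carrier Q)"
    by (simp add: Bij_def symm_def)
  moreover have "symm Q x (qsym Q y z) = qsym Q (symm Q x y) (symm Q x z)"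
    if "y \<in> carrier Q" "z \<in> carrier Q" for y z
    using sym_distrib[OF x that] that cl by (simp add: symm_def)
  ultimately show ?thesis
    using cl[OF x] by (auto simp: carrier_quandle_Aut quandle_hom_def symm_def)
qed

lemma (in quandle) symm_in_Inn: "x \<in> carrier Q \<Longrightarrow> symm Q x \<in> carrier (Inn Q)"
  unfolding Inn_def carrier_subgroup_generated
  by (rule generate.incl) (auto simp: symm_in_Aut)

lemma (in quandle) carrier_Inn_subset: "carrier (Inn Q) \<subseteq> Bij (carrier Q)"
  unfolding Inn_def
  using group.carrier_subgroup_generated_subset[OF group_quandle_Aut] carrier_quandle_Aut by fastforce

lemma (in quandle) mult_Inn:
  "\<lbrakk>g \<in> carrier (Inn Q); h \<in> carrier (Inn Q)\<rbrakk> \<Longrightarrow> g \<otimes>\<^bsub>Inn Q\<^esub> h = compose (carrier Q) g h"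
  using carrier_Inn_subset by (auto simp: Inn_def quandle_Aut_def BijGroup_def)

lemma one_Inn: "\<one>\<^bsub>Inn Q\<^esub> = (\<lambda>x\<in>carrier Q. x)"
  by (simp add: Inn_def quandle_Aut_def BijGroup_def)

lemma (in quandle) carrier_Inn_generate:
  "carrier (Inn Q) = generate (Inn Q) (symm Q ` carrier Q)"
proof -
  have "subgroup_generated (Inn Q) (symm Q ` carrier Q) = Inn Q"
    unfolding Inn_def by (rule group.subgroup_generated2[OF group_quandle_Aut])
  then have "carrier (Inn Q) = generate (Inn Q) (carrier (Inn Q) \<inter> symm Q ` carrier Q)"
    by (metis carrier_subgroup_generated)
  moreover have "carrier (Inn Q) \<inter> symm Q ` carrier Q = symm Q ` carrier Q"
    using symm_in_Inn by auto
  ultimately show ?thesis by simp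
qed

lemma ex1_Inn_map:
  assumes P: "quandle P" and Q: "quandle Q" and f: "f \<in> quandle_epi P Q"
  shows "\<exists>!h. is_Inn_map P Q f h"
proof -
  interpret P: quandle P by fact
  interpret Q: quandle Q by fact
  interpret GP: group "Inn P" by (rule P.group_Inn)
  interpret GQ: group "Inn Q" by (rule Q.group_Inn)
  define R where "R g g' \<longleftrightarrow> g' \<in> carrier (Inn Q) \<and> (\<forall>x\<in>carrier P. f (g x) = g' (f x))" for g g'
  have fP: "f x \<in> carrier Q" if "x \<in> carrier P" for x
    using f that by (auto simp: quandle_epi_def quandle_hom_def)
  have fsurj: "\<exists>x\<in>carrier P. y = f x" if "y \<in> carrier Q" for y
    using f that by (auto simp: quandle_epi_def)
  have inP: "g x \<in> carrier P" if "g \<in> carrier (Inn P)" "x \<in> carrier P" for g x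
    using that P.carrier_Inn_subset Bij_imp_funcset by blast
  have inQ: "g x \<in> carrier Q" if "g \<in> carrier (Inn Q)" "x \<in> carrier Q" for g x
    using that Q.carrier_Inn_subset Bij_imp_funcset by blast
  have R_unique: "a = b" if "R g a" "R g b" for g a b
  proof (rule extensionalityI)
    show "a \<in> extensional (carrier Q)" "b \<in> extensional (carrier Q)"
      using that Q.carrier_Inn_subset by (auto simp: R_def Bij_def)
    show "a y = b y" if "y \<in> carrier Q" for y
      using fsurj[OF that] \<open>R g a\<close> \<open>R g b\<close> by (auto simp: R_def)
  qed
  have R_symm: "R (symm P x) (symm Q (f x))" if "x \<in> carrier P" for x
    using that f fP Q.symm_in_Inn[of "f x"]
    by (auto simp: R_def symm_def quandle_epi_def quandle_hom_def)
  have R_one: "R \<one>\<^bsub>Inn P\<^esub> \<one>\<^bsub>Inn Q\<^esub>"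
    using fP GQ.one_closed by (auto simp: R_def one_Inn)
  have R_mult: "R (g \<otimes>\<^bsub>Inn P\<^esub> h) (g' \<otimes>\<^bsub>Inn Q\<^esub> h')"
    if "g \<in> carrier (Inn P)" "h \<in> carrier (Inn P)" "R g g'" "R h h'" for g h g' h'
  proof -
    have m: "g \<otimes>\<^bsub>Inn P\<^esub> h = compose (carrier P) g h" "g' \<otimes>\<^bsub>Inn Q\<^esub> h' = compose (carrier Q) g' h'"
      using that P.mult_Inn Q.mult_Inn by (auto simp: R_def)
    have "g' \<otimes>\<^bsub>Inn Q\<^esub> h' \<in> carrier (Inn Q)" using that by (auto simp: R_def)
    then show ?thesis
      using that inP fP unfolding R_def m by (auto simp: compose_def)
  qed
  have R_inv: "R (inv\<^bsub>Inn P\<^esub> g) (inv\<^bsub>Inn Q\<^esub> g')" if g: "g \<in> carrier (Inn P)" and r: "R g g'" for g g'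
  proof -
    have g': "g' \<in> carrier (Inn Q)" using r by (simp add: R_def)
    have "f ((inv\<^bsub>Inn P\<^esub> g) x) = (inv\<^bsub>Inn Q\<^esub> g') (f x)" if x: "x \<in> carrier P" for x
    proof -
      let ?y = "(inv\<^bsub>Inn P\<^esub> g) x"
      have y: "?y \<in> carrier P" using g x inP by blast
      have "g ?y = (g \<otimes>\<^bsub>Inn P\<^esub> inv\<^bsub>Inn P\<^esub> g) x"
        using P.mult_Inn[of g "inv\<^bsub>Inn P\<^esub> g"] g x by (simp add: compose_def)
      then have gy: "g ?y = x" using g x by (simp add: one_Inn)
      have "(inv\<^bsub>Inn Q\<^esub> g') (f x) = (inv\<^bsub>Inn Q\<^esub> g') (g' (f ?y))"
        using r y gy by (auto simp: R_def)
      also have "\<dots> = (inv\<^bsub>Inn Q\<^esub> g' \<otimes>\<^bsub>Inn Q\<^esub> g') (f ?y)"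
        using Q.mult_Inn[of "inv\<^bsub>Inn Q\<^esub> g'" g'] g' fP[OF y] by (simp add: compose_def)
      also have "\<dots> = f ?y" using g' fP[OF y] by (simp add: one_Inn)
      finally show ?thesis by simp
    qed
    then show ?thesis using g' by (auto simp: R_def)
  qed
  have sub: "symm P ` carrier P \<subseteq> carrier (Inn P)" using P.symm_in_Inn by auto
  have memP: "g \<in> carrier (Inn P)" if "g \<in> generate (Inn P) (symm P ` carrier P)" for g
    using that P.carrier_Inn_generate by simp
  have R_ex: "\<exists>g'. R g g'" if "g \<in> carrier (Inn P)" for g
    using that unfolding P.carrier_Inn_generate
  proof (induction rule: generate.induct)
    case one then show ?case using R_one by blast
  next
    case (incl h) then show ?case using R_symm by blast
  next
    case (inv h) then show ?case using R_symm R_inv sub by blast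
  next
    case (eng h1 h2) then show ?case using R_mult memP by blast
  qed
  have R_surj: "\<exists>g\<in>carrier (Inn P). R g g'" if "g' \<in> carrier (Inn Q)" for g'
    using that unfolding Q.carrier_Inn_generate
  proof (induction rule: generate.induct)
    case one then show ?case using R_one GP.one_closed by blast
  next
    case (incl h) then show ?case using R_symm fsurj P.symm_in_Inn by blast
  next
    case (inv h)
    then obtain x where "x \<in> carrier P" "h = symm Q (f x)" using fsurj by blast
    then show ?case using R_inv[OF P.symm_in_Inn R_symm] P.symm_in_Inn GP.inv_closed by blast
  next
    case (eng h1 h2) then show ?case using R_mult GP.m_closed by blast
  qed
  define h where "h = (\<lambda>g\<in>carrier (Inn P). THE g'. R g g')"
  have hR: "h g = g'" if "g \<in> carrier (Inn P)" "R g g'" for g g'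
    using that R_unique by (auto simp: h_def intro!: the_equality)
  have Rh: "R g (h g)" if "g \<in> carrier (Inn P)" for g
    using R_ex[OF that] hR[OF that] by auto
  have hQ: "h g \<in> carrier (Inn Q)" if "g \<in> carrier (Inn P)" for g
    using Rh[OF that] by (simp add: R_def)
  have "h \<in> hom (Inn P) (Inn Q)"
    using hQ hR R_mult Rh by (auto intro!: homI)
  moreover have "carrier (Inn Q) \<subseteq> h ` carrier (Inn P)"
    using R_surj hR by (metis image_eqI subsetI)
  moreover have "h \<in> extensional (carrier (Inn P))" by (simp add: h_def)
  moreover have "h (symm P x) = symm Q (f x)" if "x \<in> carrier P" for x
    using hR[OF P.symm_in_Inn[OF that] R_symm[OF that]] .
  ultimately have ex: "is_Inn_map P Q f h"
    by (auto simp: is_Inn_map_def epi_iff_subset)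
  have "k = h" if k: "is_Inn_map P Q f k" for k
  proof (rule extensionalityI)
    show "k \<in> extensional (carrier (Inn P))" "h \<in> extensional (carrier (Inn P))"
      using k ex by (auto simp: is_Inn_map_def)
    interpret k: group_hom "Inn P" "Inn Q" k
      using k by unfold_locales (auto simp: is_Inn_map_def epi_def)
    have ks: "k (symm P x) = symm Q (f x)" if "x \<in> carrier P" for x
      using k that by (auto simp: is_Inn_map_def)
    have "R g (k g)" if "g \<in> carrier (Inn P)" for g
      using that unfolding P.carrier_Inn_generate
    proof (induction rule: generate.induct)
      case one then show ?case using R_one by simp
    next
      case (incl h) then show ?case using R_symm ks by auto
    next
      case (inv h)
      then obtain x where "x \<in> carrier P" "h = symm P x" by blast
      then show ?case using R_inv[OF P.symm_in_Inn R_symm] ks P.symm_in_Inn by simp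
    next
      case (eng h1 h2) then show ?case using R_mult memP by simp
    qed
    then show "k g = h g" if "g \<in> carrier (Inn P)" for g
      using that hR by metis
  qed
  then show ?thesis using ex by blast
qed

end

theory Submission
  imports Defs
begin

text \<open>Let \<open>G = Inn(P)\<close> and \<open>K = Inn\<^sub>r\<^sub>e\<^sub>l(f)\<close>. Operator-reducedness says that each generator
  \<open>a = s\<^sub>x\<close> of \<open>G\<close> commutes with all its \<open>K\<close>-conjugates. It suffices that every chief factor
  \<open>M\<close> of \<open>G\<close> inside \<open>K\<close> is central, and after passing to a quotient \<open>M\<close> is a minimal normal
  subgroup. If \<open>M\<close> is not already central, some \<open>[k, a] \<noteq> 1\<close> with \<open>k \<in> M\<close> lies in an abelian
  normal subgroup of \<open>M\<close>; the \<open>G\<close>-conjugates of a minimal normal subgroup \<open>L\<close> of \<open>M\<close> inside it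
  centralise each other, so \<open>L\<close> is central in \<open>M\<close> and \<open>M\<close> is abelian. Now \<open>a\<close> acts on \<open>M\<close>
  with \<open>(a - 1)\<^sup>2 = 0\<close>, so a product of two commuting such elements has fixed points in every
  nontrivial subgroup it preserves. For a fixed \<open>a\<close> the elements \<open>[k, a]\<close>, \<open>k \<in> K\<close>, commute and
  have a common fixed point in every minimal \<open>K\<close>-invariant subgroup of \<open>M\<close>; by minimality of \<open>M\<close>
  they act trivially, so \<open>K\<close> is central modulo the centraliser of \<open>M\<close>. Descending along the lower
  central series of \<open>G\<close>, each generator \<open>[a, h] = a (h a\<inverse> h\<inverse>)\<close> of a term that is central
  modulo the centraliser is such a product; its fixed points form a nontrivial normal subgroup of
  \<open>G\<close>, hence all of \<open>M\<close>. So finally \<open>G\<close> itself acts trivially.\<close>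

section \<open>Conjugation, fixed points and invariant subgroups\<close>

definition conjug :: "('a, 'm) monoid_scheme \<Rightarrow> 'a \<Rightarrow> 'a \<Rightarrow> 'a" where
  "conjug G g x = g \<otimes>\<^bsub>G\<^esub> x \<otimes>\<^bsub>G\<^esub> inv\<^bsub>G\<^esub> g"

definition fixed_points :: "('a, 'm) monoid_scheme \<Rightarrow> 'a set \<Rightarrow> 'a set \<Rightarrow> 'a set" where
  "fixed_points G M Y = {x \<in> M. \<forall>y\<in>Y. conjug G y x = x}"

text \<open>The acting set \<open>H\<close> is arbitrary: the whole carrier gives normality, while
  smaller sets give subgroups stable under some displacements or under one element.\<close>

definition invariant_subgroup :: "('a, 'm) monoid_scheme \<Rightarrow> 'a set \<Rightarrow> 'a set \<Rightarrow> bool" where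
  "invariant_subgroup G H V \<longleftrightarrow> subgroup V G \<and> (\<forall>h\<in>H. \<forall>v\<in>V. conjug G h v \<in> V)"

text \<open>For \<open>M = Inn_rel P Q f\<close> and \<open>a = symm P x\<close> this is
  operator-reducedness, because conjugating \<open>symm P x\<close> by \<phi> gives
  \<open>symm P (\<phi> x)\<close>.\<close>

definition self_commuting :: "('a, 'm) monoid_scheme \<Rightarrow> 'a set \<Rightarrow> 'a set" where
  "self_commuting G M = {a \<in> carrier G. \<forall>x\<in>M. conjug G a (conjug G x a) = conjug G x a}"

context group
begin

lemma inv_cancel_left [simp]:
  assumes "x \<in> carrier G" "y \<in> carrier G"
  shows "inv x \<otimes> (x \<otimes> y) = y" "x \<otimes> (inv x \<otimes> y) = y"
  using assms by (simp_all flip: m_assoc)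

lemma conjug_closed [simp]: "\<lbrakk>g \<in> carrier G; x \<in> carrier G\<rbrakk> \<Longrightarrow> conjug G g x \<in> carrier G"
  by (simp add: conjug_def)

lemma conjug_mult:
  "\<lbrakk>g \<in> carrier G; x \<in> carrier G; y \<in> carrier G\<rbrakk> \<Longrightarrow> conjug G g (x \<otimes> y) = conjug G g x \<otimes> conjug G g y"
  by (simp add: conjug_def m_assoc)

lemma conjug_one [simp]: "g \<in> carrier G \<Longrightarrow> conjug G g \<one> = \<one>"
  by (simp add: conjug_def)

lemma one_conjug [simp]: "x \<in> carrier G \<Longrightarrow> conjug G \<one> x = x"
  by (simp add: conjug_def)

lemma conjug_inv:
  "\<lbrakk>g \<in> carrier G; x \<in> carrier G\<rbrakk> \<Longrightarrow> conjug G g (inv x) = inv (conjug G g x)"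
  by (simp add: conjug_def inv_mult_group m_assoc)

lemma mult_conjug:
  "\<lbrakk>g \<in> carrier G; h \<in> carrier G; x \<in> carrier G\<rbrakk> \<Longrightarrow> conjug G (g \<otimes> h) x = conjug G g (conjug G h x)"
  by (simp add: conjug_def inv_mult_group m_assoc)

lemma conjug_conjug:
  "\<lbrakk>g \<in> carrier G; h \<in> carrier G; x \<in> carrier G\<rbrakk> \<Longrightarrow>
    conjug G (conjug G g h) (conjug G g x) = conjug G g (conjug G h x)"
  by (simp add: conjug_def inv_mult_group m_assoc)

lemma conjug_inv_cancel [simp]:
  "\<lbrakk>g \<in> carrier G; x \<in> carrier G\<rbrakk> \<Longrightarrow> conjug G (inv g) (conjug G g x) = x"
  "\<lbrakk>g \<in> carrier G; x \<in> carrier G\<rbrakk> \<Longrightarrow> conjug G g (conjug G (inv g) x) = x"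
  by (simp_all flip: mult_conjug)

lemma conjug_eq_iff:
  "\<lbrakk>g \<in> carrier G; x \<in> carrier G; y \<in> carrier G\<rbrakk> \<Longrightarrow> conjug G g x = y \<longleftrightarrow> g \<otimes> x = y \<otimes> g"
  by (metis conjug_def inv_solve_right m_closed)

lemma conjug_fix_sym:
  assumes "g \<in> carrier G" "x \<in> carrier G" "conjug G g x = x"
  shows "conjug G x g = g"
  using assms conjug_eq_iff by metis

lemma conjug_fix_inv:
  assumes "g \<in> carrier G" "x \<in> carrier G" "conjug G g x = x"
  shows "conjug G (inv g) x = x"
  using assms conjug_inv_cancel(1) by metis

lemma subgroup_fixed_points:
  assumes M: "subgroup M G" and Y: "Y \<subseteq> carrier G"
  shows "subgroup (fixed_points G M Y) G"
proof
  show "fixed_points G M Y \<subseteq> carrier G"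
    using subgroup.subset[OF M] by (auto simp: fixed_points_def)
  show "\<one> \<in> fixed_points G M Y"
    using subgroup.one_closed[OF M] Y by (auto simp: fixed_points_def)
  show "x \<otimes> y \<in> fixed_points G M Y" if "x \<in> fixed_points G M Y" "y \<in> fixed_points G M Y" for x y
    using that subgroup.m_closed[OF M] subgroup.subset[OF M] Y
    by (auto simp: fixed_points_def conjug_mult subset_iff)
  show "inv x \<in> fixed_points G M Y" if "x \<in> fixed_points G M Y" for x
    using that subgroup.m_inv_closed[OF M] subgroup.subset[OF M] Y
    by (auto simp: fixed_points_def conjug_inv subset_iff)
qed

text \<open>An element y fixes h x h^-1 if and only if h^-1 y h fixes x. Asking for the latter only
  at points x already fixed by \<open>Y\<close> also covers sets \<open>Y\<close> whose conjugates
  are merely products of elements of \<open>Y\<close> and their inverses.\<close>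

lemma invariant_fixed_points:
  assumes M: "invariant_subgroup G H M" and Y: "Y \<subseteq> carrier G" and H: "H \<subseteq> carrier G"
    and inv: "\<And>h y x. \<lbrakk>h \<in> H; y \<in> Y; x \<in> fixed_points G M Y\<rbrakk> \<Longrightarrow> conjug G (conjug G (inv h) y) x = x"
  shows "invariant_subgroup G H (fixed_points G M Y)"
  unfolding invariant_subgroup_def
proof (intro conjI ballI)
  have Ms: "subgroup M G" using M by (simp add: invariant_subgroup_def)
  show "subgroup (fixed_points G M Y) G" by (rule subgroup_fixed_points[OF Ms Y])
  fix h x assume h: "h \<in> H" and x: "x \<in> fixed_points G M Y"
  have c: "h \<in> carrier G" "x \<in> carrier G" "x \<in> M"
    using h x H subgroup.subset[OF Ms] by (auto simp: fixed_points_def)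
  have "conjug G y (conjug G h x) = conjug G h x" if y: "y \<in> Y" for y
  proof -
    have "y \<in> carrier G" using y Y by auto
    then have "conjug G y (conjug G h x) = conjug G h (conjug G (conjug G (inv h) y) x)"
      using conjug_conjug[of h "conjug G (inv h) y" x] c by simp
    then show ?thesis using inv[OF h y x] by simp
  qed
  then show "conjug G h x \<in> fixed_points G M Y"
    using M h c by (auto simp: fixed_points_def invariant_subgroup_def)
qed

lemma normal_iff_invariant: "N \<lhd> G \<longleftrightarrow> invariant_subgroup G (carrier G) N"
  by (auto simp: normal_inv_iff invariant_subgroup_def conjug_def)

lemma minimal_normal_eqI:
  assumes "minimal_normal M G" "invariant_subgroup G (carrier G) V" "V \<subseteq> M" "w \<in> V" "w \<noteq> \<one>"
  shows "V = M"
  using assms by (auto simp: minimal_normal_def normal_iff_invariant)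

text \<open>Minimality is phrased with a witness \<open>v\<close>, so that later a single nontrivial
  fixed point forces an invariant subgroup to be all of \<open>W\<close>.\<close>

lemma ex_minimal_invariant:
  assumes "finite M" "invariant_subgroup G H M" "w \<in> M" "w \<noteq> \<one>"
  obtains W where "W \<subseteq> M" "invariant_subgroup G H W" "W \<noteq> {\<one>}"
    "\<And>V v. \<lbrakk>invariant_subgroup G H V; V \<subseteq> W; v \<in> V; v \<noteq> \<one>\<rbrakk> \<Longrightarrow> V = W"
proof -
  let ?A = "{W. W \<subseteq> M \<and> invariant_subgroup G H W \<and> W \<noteq> {\<one>}}"
  have "finite ?A" using assms(1) by simp
  moreover have "M \<in> ?A" using assms by auto
  ultimately obtain W where W: "W \<in> ?A" and min: "\<And>V. V \<in> ?A \<Longrightarrow> V \<subseteq> W \<Longrightarrow> W = V"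
    using finite_has_minimal2[of ?A M] by auto
  show ?thesis
  proof (rule that[of W])
    fix V v assume "invariant_subgroup G H V" "V \<subseteq> W" "v \<in> V" "v \<noteq> \<one>"
    then show "V = W" using min[of V] W by auto
  qed (use W in auto)
qed

lemma invariant_nontrivial:
  assumes "invariant_subgroup G H W" "W \<noteq> {\<one>}"
  obtains w where "w \<in> W" "w \<noteq> \<one>" "w \<in> carrier G"
proof -
  have "subgroup W G" using assms by (simp add: invariant_subgroup_def)
  then show ?thesis using that assms(2) subgroup.one_closed subgroup.subset by blast
qed

section \<open>Elements commuting with their conjugates\<close>

lemma inv_self_commuting:
  assumes a: "a \<in> self_commuting G M" and M: "M \<subseteq> carrier G"
  shows "inv a \<in> self_commuting G M"
  using assms conjug_inv conjug_fix_inv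
  by (auto simp: self_commuting_def subset_iff)

lemma conjug_self_commuting:
  assumes a: "a \<in> self_commuting G M" and M: "invariant_subgroup G (carrier G) M" and g: "g \<in> carrier G"
  shows "conjug G g a \<in> self_commuting G M"
proof -
  have ac: "a \<in> carrier G" using a by (simp add: self_commuting_def)
  have "conjug G (conjug G g a) (conjug G x (conjug G g a)) = conjug G x (conjug G g a)" if x: "x \<in> M" for x
  proof -
    let ?x = "conjug G (inv g) x"
    have xM: "?x \<in> M" using x g M by (simp add: invariant_subgroup_def)
    have xc: "x \<in> carrier G" "?x \<in> carrier G" using M x xM subgroup.subset by (auto simp: invariant_subgroup_def)
    have e: "conjug G x (conjug G g a) = conjug G g (conjug G ?x a)"
      using conjug_conjug[of g ?x a] xc g ac by simp
    have "conjug G a (conjug G ?x a) = conjug G ?x a" using a xM by (simp add: self_commuting_def)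
    then show ?thesis unfolding e using conjug_conjug[of g a "conjug G ?x a"] xc g ac by simp
  qed
  then show ?thesis using ac g by (simp add: self_commuting_def)
qed

lemma one_self_commuting: "M \<subseteq> carrier G \<Longrightarrow> \<one> \<in> self_commuting G M"
  by (auto simp: self_commuting_def subset_iff)

text \<open>Writing \<open>D\<^sub>g x = g x g\<inverse> x\<inverse>\<close>, self-commutation of \<open>a\<close> and \<open>b\<close> says \<open>D\<^sub>a\<^sup>2 = D\<^sub>b\<^sup>2 = 0\<close>
  on the abelian group \<open>M\<close>, whence \<open>D\<^bsub>ab\<^esub> = D\<^sub>a D\<^sub>b + D\<^sub>a + D\<^sub>b\<close> satisfies \<open>D\<^bsub>ab\<^esub>\<^sup>3 = 0\<close>.\<close>

lemma self_commuting_fixed_point: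
  assumes M: "invariant_subgroup G (carrier G) M"
    and ab: "\<And>x y. \<lbrakk>x \<in> M; y \<in> M\<rbrakk> \<Longrightarrow> x \<otimes> y = y \<otimes> x"
    and a: "a \<in> self_commuting G M" and b: "b \<in> self_commuting G M"
    and comm: "\<And>x. x \<in> M \<Longrightarrow> conjug G a (conjug G b x) = conjug G b (conjug G a x)"
    and W: "invariant_subgroup G {a \<otimes> b} W" "W \<subseteq> M" "w \<in> W" "w \<noteq> \<one>"
  obtains v where "v \<in> W" "v \<noteq> \<one>" "conjug G (a \<otimes> b) v = v"
proof -
  note concl = that
  have Ms: "subgroup M G" using M by (simp add: invariant_subgroup_def)
  have MG: "x \<in> carrier G" if "x \<in> M" for x using subgroup.subset[OF Ms] that by auto
  have Mm: "x \<otimes> y \<in> M" if "x \<in> M" "y \<in> M" for x y using subgroup.m_closed[OF Ms] that .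
  have Mi: "inv x \<in> M" if "x \<in> M" for x using subgroup.m_inv_closed[OF Ms] that .
  have Mc: "conjug G g x \<in> M" if "g \<in> carrier G" "x \<in> M" for g x
    using M that by (simp add: invariant_subgroup_def)
  have c: "a \<in> carrier G" "b \<in> carrier G" using a b by (auto simp: self_commuting_def)
  have lc: "x \<otimes> (y \<otimes> z) = y \<otimes> (x \<otimes> z)" if "x \<in> M" "y \<in> M" "z \<in> M" for x y z
    using that MG ab by (metis m_assoc)
  define D where "D g x = conjug G g x \<otimes> inv x" for g x
  have DM: "D g x \<in> M" if "g \<in> carrier G" "x \<in> M" for g x
    unfolding D_def using that Mm Mi Mc by simp
  have cD: "conjug G g x = D g x \<otimes> x" if "g \<in> carrier G" "x \<in> M" for g x
    unfolding D_def using that MG by (simp add: m_assoc)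
  have D1: "D g x = \<one> \<longleftrightarrow> conjug G g x = x" if "g \<in> carrier G" "x \<in> M" for g x
    unfolding D_def using that MG Mc by (metis inv_equality inv_inv inv_closed r_inv conjug_closed)
  have Dmult: "D g (x \<otimes> y) = D g x \<otimes> D g y" if "g \<in> carrier G" "x \<in> M" "y \<in> M" for g x y
    unfolding D_def using that MG Mc Mi Mm
    by (simp add: conjug_mult inv_mult_group m_assoc lc ab)
  have Done: "D g \<one> = \<one>" if "g \<in> carrier G" for g
    using that by (simp add: D_def)
  have Dab: "D (a \<otimes> b) x = D a (D b x) \<otimes> (D b x \<otimes> D a x)" if x: "x \<in> M" for x
  proof -
    have "conjug G (a \<otimes> b) x = conjug G a (D b x \<otimes> x)"
      using c x MG by (simp add: mult_conjug cD[of b x])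
    also have "\<dots> = conjug G a (D b x) \<otimes> conjug G a x"
      using c x MG DM by (simp add: conjug_mult)
    also have "\<dots> = D a (D b x) \<otimes> D b x \<otimes> (D a x \<otimes> x)"
      using c x DM by (simp add: cD)
    finally show ?thesis using c x MG DM by (simp add: D_def[of "a \<otimes> b"] m_assoc)
  qed
  have Dcomm: "D a (D b x) = D b (D a x)" if x: "x \<in> M" for x
  proof -
    have "D a (D b x) = conjug G a (conjug G b x) \<otimes> (inv (conjug G a x) \<otimes> (x \<otimes> inv (conjug G b x)))"
      unfolding D_def using c x MG Mc Mi by (simp add: conjug_mult conjug_inv inv_mult_group m_assoc)
    moreover have "D b (D a x) = conjug G b (conjug G a x) \<otimes> (inv (conjug G b x) \<otimes> (x \<otimes> inv (conjug G a x)))"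
      unfolding D_def using c x MG Mc Mi by (simp add: conjug_mult conjug_inv inv_mult_group m_assoc)
    moreover have "inv (conjug G a x) \<otimes> (x \<otimes> inv (conjug G b x)) = inv (conjug G b x) \<otimes> (x \<otimes> inv (conjug G a x))"
      using c x Mc Mi lc ab Mm by metis
    ultimately show ?thesis using comm[OF x] by simp
  qed
  have DD: "D e (D e x) = \<one>" if e: "e \<in> self_commuting G M" and x: "x \<in> M" for e x
  proof -
    have ec: "e \<in> carrier G" using e by (simp add: self_commuting_def)
    \<comment> \<open>Regrouped in this way, \<open>D e x\<close> is a product of two elements
      commuting with \<open>e\<close>, hence fixed by \<open>e\<close>.\<close>
    have eq: "D e x = e \<otimes> inv (conjug G x e)"
      using ec x MG by (simp add: D_def conjug_def inv_mult_group m_assoc)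
    have "conjug G e (conjug G x e) = conjug G x e" using e x by (simp add: self_commuting_def)
    then have "conjug G e (D e x) = D e x"
      unfolding eq using ec x MG by (simp add: conjug_mult conjug_inv) (simp add: conjug_def m_assoc)
    then show ?thesis using D1[OF ec DM[OF ec x]] by simp
  qed
  \<comment> \<open>A filtration of \<open>M\<close>: by \<open>Dab\<close>,
    \<open>D (a \<otimes> b)\<close> maps \<open>M\<close> into \<open>M2\<close>, \<open>M2\<close>
    into \<open>M1\<close>, and \<open>M1\<close> to \<one>.\<close>
  define M1 where "M1 = {x \<in> M. D a x = \<one> \<and> D b x = \<one>}"
  define M2 where "M2 = {x \<in> M. D a x \<in> M1 \<and> D b x \<in> M1}"
  have M1m: "x \<otimes> y \<in> M1" if "x \<in> M1" "y \<in> M1" for x y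
    using that c Mm by (simp add: M1_def Dmult)
  have M2m: "x \<otimes> y \<in> M2" if "x \<in> M2" "y \<in> M2" for x y
    using that c Mm M1m by (simp add: M2_def Dmult)
  have one1: "\<one> \<in> M1" using subgroup.one_closed[OF Ms] c Done by (simp add: M1_def)
  have M12: "x \<in> M2" if "x \<in> M1" for x using that one1 by (simp add: M2_def M1_def)
  have E0: "D (a \<otimes> b) x = \<one>" if "x \<in> M1" for x
    using that Dab c Done by (simp add: M1_def)
  have E1: "D (a \<otimes> b) x \<in> M1" if x: "x \<in> M2" for x
  proof -
    have "x \<in> M" "D a (D b x) = \<one>" using x by (auto simp: M2_def M1_def)
    then show ?thesis using x Dab one1 M1m by (simp add: M2_def)
  qed
  have E2: "D (a \<otimes> b) x \<in> M2" if x: "x \<in> M" for x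
  proof -
    have l: "D a (D b x) \<in> M1"
      using DM DD[OF a] DD[OF b] c x Done Dcomm Dcomm[of "D b x"] unfolding M1_def by simp
    then have l': "D b (D a x) \<in> M1" using Dcomm x by simp
    have "D a x \<in> M2" "D b x \<in> M2"
      using DM DD[OF a] DD[OF b] c x one1 l l' unfolding M2_def by simp_all
    then show ?thesis using Dab[OF x] M2m M12[OF l] by simp
  qed
  have DW: "D (a \<otimes> b) x \<in> W" if "x \<in> W" for x
    using W(1) that unfolding D_def invariant_subgroup_def
    by (auto intro: subgroup.m_closed subgroup.m_inv_closed)
  have fin: ?thesis if "v \<in> W" "v \<noteq> \<one>" "D (a \<otimes> b) v = \<one>" for v
    using that W(2) D1[of "a \<otimes> b" v] c by (intro concl[of v]) auto
  \<comment> \<open>Among \<open>w\<close>, \<open>?d w\<close> and \<open>?d (?d w)\<close>, all in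
    \<open>W\<close>, the last one different from \<one> is the fixed point.\<close>
  let ?d = "D (a \<otimes> b)"
  have 3: "?d (?d (?d w)) = \<one>" using E0 E1 E2 W by blast
  show ?thesis
    using fin[of w] fin[of "?d w"] fin[of "?d (?d w)"] 3 W DW by metis
qed

end

section \<open>Displacements, the commutators [g, a] for a fixed a\<close>

definition displacement :: "('a, 'm) monoid_scheme \<Rightarrow> 'a \<Rightarrow> 'a \<Rightarrow> 'a" where
  "displacement G a g = conjug G g a \<otimes>\<^bsub>G\<^esub> inv\<^bsub>G\<^esub> a"

context group
begin

lemma generate_fixes:
  assumes T: "T \<subseteq> carrier G" and M: "M \<subseteq> carrier G"
    and fix1: "\<And>a x. \<lbrakk>a \<in> T; x \<in> M\<rbrakk> \<Longrightarrow> conjug G a x = x"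
    and g: "g \<in> generate G T" and x: "x \<in> M"
  shows "conjug G g x = x"
  using g x
proof (induction arbitrary: x rule: generate.induct)
  case one then show ?case using M by auto
next
  case (incl h) then show ?case using fix1 by simp
next
  case (inv h) then show ?case using fix1 T M conjug_fix_inv by blast
next
  case (eng h1 h2)
  then have "h1 \<in> carrier G" "h2 \<in> carrier G" "x \<in> carrier G"
    using generate_in_carrier[OF T] M by auto
  then show ?case using eng by (simp add: mult_conjug)
qed

lemma displacement_closed [simp]:
  "\<lbrakk>a \<in> carrier G; g \<in> carrier G\<rbrakk> \<Longrightarrow> displacement G a g \<in> carrier G"
  by (simp add: displacement_def)

lemma displacement_in_normal:
  assumes K: "invariant_subgroup G (carrier G) K" and a: "a \<in> carrier G" and g: "g \<in> K"
  shows "displacement G a g \<in> K"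
proof -
  have Ks: "subgroup K G" using K by (simp add: invariant_subgroup_def)
  have gc: "g \<in> carrier G" using subgroup.subset[OF Ks] g by auto
  have "displacement G a g = g \<otimes> conjug G a (inv g)"
    using a gc by (simp add: displacement_def conjug_def m_assoc)
  moreover have "conjug G a (inv g) \<in> K"
    using K a g subgroup.m_inv_closed[OF Ks] by (simp add: invariant_subgroup_def)
  ultimately show ?thesis using subgroup.m_closed[OF Ks g] by simp
qed

text \<open>The cocycle identity [h g, a] = h [g, a] h^-1 [h, a], solved for the conjugate. It keeps
  \<open>a\<close> fixed, whereas \<open>displacement_conjug\<close> moves \<open>a\<close> as
  well.\<close>

lemma conjug_displacement:
  assumes "a \<in> carrier G" "g \<in> carrier G" "h \<in> carrier G"
  shows "conjug G h (displacement G a g) = displacement G a (h \<otimes> g) \<otimes> inv (displacement G a h)"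
  using assms by (simp add: displacement_def conjug_mult mult_conjug conjug_inv inv_mult_group m_assoc)

lemma displacement_conjug:
  assumes "a \<in> carrier G" "g \<in> carrier G" "h \<in> carrier G"
  shows "conjug G h (displacement G a g) = displacement G (conjug G h a) (conjug G h g)"
  using assms by (simp add: displacement_def conjug_mult conjug_conjug conjug_inv)

text \<open>Conjugating by g^-1 reduces the claim to \<open>a\<close> and its conjugate by
  \<open>inv g \<otimes> h\<close>.\<close>

lemma self_commuting_conjugates:
  assumes K: "subgroup K G" and a: "a \<in> self_commuting G K" and "g \<in> K" "h \<in> K"
  shows "conjug G (conjug G g a) (conjug G h a) = conjug G h a"
proof -
  have c: "a \<in> carrier G" "g \<in> carrier G" "h \<in> carrier G"
    using assms subgroup.subset[OF K] by (auto simp: self_commuting_def)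
  have k: "inv g \<otimes> h \<in> K" using assms subgroup.m_closed[OF K] subgroup.m_inv_closed[OF K] by simp
  have e: "conjug G h a = conjug G g (conjug G (inv g \<otimes> h) a)"
    using c by (simp flip: mult_conjug)
  have "conjug G a (conjug G (inv g \<otimes> h) a) = conjug G (inv g \<otimes> h) a"
    using a k by (simp add: self_commuting_def)
  then show ?thesis unfolding e using c by (simp add: conjug_conjug)
qed

text \<open>Both are products of \<open>K\<close>-conjugates of \<open>a\<close> and
  \<open>inv a\<close>, where \<open>a\<close> is its own conjugate by \<one>, and all of these
  commute.\<close>

lemma displacements_commute:
  assumes K: "subgroup K G" and a: "a \<in> self_commuting G K" and g: "g \<in> K" and h: "h \<in> K"
  shows "conjug G (displacement G a g) (displacement G a h) = displacement G a h"
proof -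
  have c: "a \<in> carrier G" "g \<in> carrier G" "h \<in> carrier G"
    using assms subgroup.subset[OF K] by (auto simp: self_commuting_def)
  have one: "\<one> \<in> K" by (rule subgroup.one_closed[OF K])
  have ah: "conjug G a (conjug G h a) = conjug G h a" and ga: "conjug G (conjug G g a) a = a"
    using self_commuting_conjugates[OF K a one h] self_commuting_conjugates[OF K a g one] c by simp_all
  have aa: "conjug G (inv a) a = a" using c by (simp add: conjug_def)
  have ah': "conjug G (inv a) (conjug G h a) = conjug G h a"
    using ah c by (simp add: conjug_fix_inv)
  show ?thesis
    unfolding displacement_def
    using c ah' aa ga self_commuting_conjugates[OF K a g h]
    by (simp add: mult_conjug conjug_mult conjug_inv)
qed

text \<open>By \<open>conjug_displacement\<close>, conjugation by \<open>K\<close> turns a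
  displacement of \<open>a\<close> into a displacement times the inverse of another one; common
  fixed points are fixed by such products.\<close>

lemma invariant_fixed_displacements:
  assumes K: "subgroup K G" and W: "invariant_subgroup G K W" and a: "a \<in> carrier G"
  shows "invariant_subgroup G K (fixed_points G W (displacement G a ` K))"
proof (rule invariant_fixed_points[OF W])
  have Kc: "K \<subseteq> carrier G" by (rule subgroup.subset[OF K])
  then show "K \<subseteq> carrier G" "displacement G a ` K \<subseteq> carrier G" using a by auto
  fix h y x assume h: "h \<in> K" and y: "y \<in> displacement G a ` K"
    and x: "x \<in> fixed_points G W (displacement G a ` K)"
  obtain g where g: "g \<in> K" "y = displacement G a g" using y by auto
  have k: "inv h \<in> K" "inv h \<otimes> g \<in> K"
    using h g subgroup.m_closed[OF K] subgroup.m_inv_closed[OF K] by auto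
  have c: "g \<in> carrier G" "inv h \<in> carrier G" "inv h \<otimes> g \<in> carrier G" "h \<in> carrier G"
    using g h k Kc by auto
  have xc: "x \<in> carrier G"
    using x W subgroup.subset by (auto simp: fixed_points_def invariant_subgroup_def)
  have f: "conjug G (displacement G a k) x = x" if "k \<in> K" for k
    using x that by (simp add: fixed_points_def)
  have "conjug G (inv (displacement G a (inv h))) x = x"
    using conjug_fix_inv[of "displacement G a (inv h)" x] f[OF k(1)] c a xc by simp
  then show "conjug G (conjug G (inv h) y) x = x"
    unfolding g(2) conjug_displacement[OF a c(1,2)]
    using f[OF k(2)] c a xc by (simp add: mult_conjug)
qed

section \<open>Minimal normal subgroups: commutativity and action of displacements\<close>

lemma invariant_subgroup_mono:
  "\<lbrakk>invariant_subgroup G H W; H' \<subseteq> H\<rbrakk> \<Longrightarrow> invariant_subgroup G H' W"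
  by (auto simp: invariant_subgroup_def)

lemma invariant_subgroupD:
  "\<lbrakk>invariant_subgroup G H W; h \<in> H; w \<in> W\<rbrakk> \<Longrightarrow> conjug G h w \<in> W"
  by (simp add: invariant_subgroup_def)

lemma invariant_subgroup_Int:
  assumes "invariant_subgroup G H V" "invariant_subgroup G H W"
  shows "invariant_subgroup G H (V \<inter> W)"
  using assms by (auto simp: invariant_subgroup_def intro: subgroups_Inter_pair)

lemma invariant_subgroup_conjug_image:
  assumes H: "invariant_subgroup G (carrier G) H" and V: "invariant_subgroup G H V"
    and g: "g \<in> carrier G"
  shows "invariant_subgroup G H (conjug G g ` V)"
  unfolding invariant_subgroup_def
proof (intro conjI ballI)
  have Vs: "subgroup V G" and Hs: "subgroup H G" using V H by (simp_all add: invariant_subgroup_def)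
  have Vc: "v \<in> carrier G" if "v \<in> V" for v using subgroup.subset[OF Vs] that by auto
  have Hc: "h \<in> carrier G" if "h \<in> H" for h using subgroup.subset[OF Hs] that by auto
  show "subgroup (conjug G g ` V) G"
  proof (rule subgroupI)
    show "conjug G g ` V \<subseteq> carrier G" using Vc g by auto
    show "conjug G g ` V \<noteq> {}" using subgroup.one_closed[OF Vs] by auto
    show "inv y \<in> conjug G g ` V" if "y \<in> conjug G g ` V" for y
      using that subgroup.m_inv_closed[OF Vs] Vc g by (auto simp flip: conjug_inv)
    show "y \<otimes> z \<in> conjug G g ` V" if "y \<in> conjug G g ` V" "z \<in> conjug G g ` V" for y z
      using that subgroup.m_closed[OF Vs] Vc g by (auto simp flip: conjug_mult)
  qed
  fix h y assume h: "h \<in> H" and "y \<in> conjug G g ` V"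
  then obtain v where v: "v \<in> V" "y = conjug G g v" by auto
  have k: "conjug G (inv g) h \<in> H" using H h g by (simp add: invariant_subgroup_def)
  then have "conjug G (conjug G (inv g) h) v \<in> V" using V v by (simp add: invariant_subgroup_def)
  moreover have "conjug G h y = conjug G g (conjug G (conjug G (inv g) h) v)"
    using conjug_conjug[of g "conjug G (inv g) h" v] g Hc[OF h] Vc[OF v(1)] v(2) by simp
  ultimately show "conjug G h y \<in> conjug G g ` V" by blast
qed

text \<open>If \<open>T\<close> centralises \<open>M\<close>, so does \<open>G\<close>. Otherwise a
  nontrivial [g, a] leads to a nontrivial central element of \<open>M\<close>, and the centre of
  \<open>M\<close>, being normal in \<open>G\<close>, is then all of \<open>M\<close>.\<close>

lemma minimal_normal_abelian:
  assumes M: "minimal_normal M G" and fin: "finite M"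
    and T: "generate G T = carrier G" "T \<subseteq> self_commuting G M"
    and x: "x \<in> M" and y: "y \<in> M"
  shows "conjug G x y = y"
proof -
  have Mi: "invariant_subgroup G (carrier G) M"
    using M by (simp add: minimal_normal_def normal_iff_invariant)
  then have Ms: "subgroup M G" by (simp add: invariant_subgroup_def)
  note Mc = subgroup.subset[OF Ms]
  have MM: "invariant_subgroup G M M" by (rule invariant_subgroup_mono[OF Mi Mc])
  have Xc: "T \<subseteq> carrier G" using T(2) by (auto simp: self_commuting_def)
  show ?thesis
  proof (cases "\<forall>a\<in>T. \<forall>g\<in>M. conjug G a g = g")
    case True
    then show ?thesis using generate_fixes[OF Xc Mc] T(1) x y Mc by auto
  next
    case False
    then obtain a g where a: "a \<in> T" and g: "g \<in> M" and ag: "conjug G a g \<noteq> g" by blast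
    have aS: "a \<in> self_commuting G M" and ac: "a \<in> carrier G" using a T(2) Xc by auto
    have gc: "g \<in> carrier G" using g Mc by auto
    \<comment> \<open>The elements of \<open>E\<close> commute with each other, so \<open>E\<close>
      lies in its centraliser \<open>F\<close> in \<open>M\<close>, and even in the centre
      \<open>Z\<close> of \<open>F\<close>. This \<open>Z\<close> is abelian, normal in
      \<open>M\<close> and nontrivial.\<close>
    define E where "E = displacement G a ` M"
    define F where "F = fixed_points G M E"
    define Z where "Z = fixed_points G F F"
    have EM: "E \<subseteq> M" unfolding E_def using displacement_in_normal[OF Mi ac] by auto
    have EF: "E \<subseteq> F"
      using EM displacements_commute[OF Ms aS] by (auto simp: F_def E_def fixed_points_def)
    have Fi: "invariant_subgroup G M F"
      unfolding F_def E_def by (rule invariant_fixed_displacements[OF Ms MM ac])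
    have FM: "F \<subseteq> M" by (auto simp: F_def fixed_points_def)
    have ZF: "Z \<subseteq> F" by (auto simp: Z_def fixed_points_def)
    have Zi: "invariant_subgroup G M Z"
      unfolding Z_def
    proof (rule invariant_fixed_points[OF Fi])
      fix h z v assume "h \<in> M" "z \<in> F" "v \<in> fixed_points G F F"
      moreover from this have "conjug G (inv h) z \<in> F"
        using Fi subgroup.m_inv_closed[OF Ms] by (simp add: invariant_subgroup_def)
      ultimately show "conjug G (conjug G (inv h) z) v = v" by (simp add: fixed_points_def)
    qed (use FM Mc in auto)
    have EZ: "E \<subseteq> Z"
    proof
      fix e assume e: "e \<in> E"
      have "conjug G z e = e" if z: "z \<in> F" for z
        using conjug_fix_sym[of e z] e z EM FM Mc by (auto simp: F_def fixed_points_def)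
      then show "e \<in> Z" using e EF by (auto simp: Z_def fixed_points_def)
    qed
    define e where "e = displacement G a g"
    have eZ: "e \<in> Z" using EZ g by (auto simp: E_def e_def)
    have "e \<noteq> \<one>"
    proof
      assume "e = \<one>"
      then have "conjug G g a = a"
        using ac gc by (metis e_def displacement_def conjug_closed inv_equality inv_inv inv_closed)
      then show False using ag ac gc conjug_fix_sym by blast
    qed
    then obtain L where LZ: "L \<subseteq> Z" and Li: "invariant_subgroup G M L" and L1: "L \<noteq> {\<one>}"
      and Lmin: "\<And>V v. \<lbrakk>invariant_subgroup G M V; V \<subseteq> L; v \<in> V; v \<noteq> \<one>\<rbrakk> \<Longrightarrow> V = L"
      using ex_minimal_invariant[OF finite_subset[OF order_trans[OF ZF FM] fin] Zi eZ] by metis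
    have Ls: "subgroup L G" using Li by (simp add: invariant_subgroup_def)
    have LM: "L \<subseteq> M" using LZ ZF FM by auto
    then have Lc: "L \<subseteq> carrier G" using Mc by auto
    have Lab: "conjug G k l = l" if "k \<in> L" "l \<in> L" for k l
      using that LZ ZF by (auto simp: Z_def fixed_points_def)
    define Y where "Y = (\<Union>h\<in>carrier G. conjug G h ` L)"
    have YM: "Y \<subseteq> M" using LM Mi by (auto simp: Y_def invariant_subgroup_def)
    have YL: "conjug G u l = l" if u: "u \<in> Y" and l: "l \<in> L" for u l
    proof -
      obtain h k where h: "h \<in> carrier G" and k: "k \<in> L" "u = conjug G h k" using u by (auto simp: Y_def)
      let ?L = "conjug G h ` L"
      have Li': "invariant_subgroup G M ?L" by (rule invariant_subgroup_conjug_image[OF Mi Li h])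
      have Ls': "subgroup ?L G" using Li' by (simp add: invariant_subgroup_def)
      have uc: "u \<in> carrier G" "u \<in> M" "u \<in> ?L" and lc: "l \<in> carrier G" "l \<in> M"
        using u l YM Mc LM k by auto
      \<comment> \<open>\<open>L\<close> and \<open>?L\<close> are both normal in \<open>M\<close>.
        If they meet trivially, the commutator of \<open>u\<close> and \<open>l\<close>, lying in
        both, vanishes. Otherwise \<open>L \<subseteq> ?L\<close> by minimality, so \<open>u\<close>
        and \<open>l\<close> are conjugates by the same \<open>h\<close> of elements of the abelian
        \<open>L\<close>.\<close>
      show ?thesis
      proof (cases "L \<inter> ?L = {\<one>}")
        case True
        let ?c = "conjug G u l \<otimes> inv l"
        have "conjug G u l \<in> L" using Li uc l by (simp add: invariant_subgroup_def)
        then have "?c \<in> L" using l subgroup.m_closed[OF Ls] subgroup.m_inv_closed[OF Ls] by blast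
        moreover have "?c = u \<otimes> conjug G l (inv u)" using uc lc by (simp add: conjug_def m_assoc)
        moreover have "conjug G l (inv u) \<in> ?L"
          using invariant_subgroupD[OF Li' lc(2)] uc subgroup.m_inv_closed[OF Ls'] by blast
        ultimately have "?c \<in> L \<inter> ?L" using uc subgroup.m_closed[OF Ls'] by simp
        then have "?c = \<one>" using True by auto
        then show ?thesis using uc lc by (metis conjug_closed inv_equality inv_inv inv_closed)
      next
        case False
        have Ii: "invariant_subgroup G M (L \<inter> ?L)" by (rule invariant_subgroup_Int[OF Li Li'])
        obtain v where v: "v \<in> L \<inter> ?L" "v \<noteq> \<one>" by (rule invariant_nontrivial[OF Ii False])
        have "L \<inter> ?L = L" by (rule Lmin[OF Ii _ v]) simp
        then obtain l2 where l2: "l2 \<in> L" "l = conjug G h l2" using l by auto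
        moreover have "k \<in> carrier G" "l2 \<in> carrier G" using k l2 Lc by auto
        ultimately show ?thesis using k(2) h Lab[OF k(1) l2(1)] by (simp add: conjug_conjug)
      qed
    qed
    obtain l where l: "l \<in> L" "l \<noteq> \<one>" "l \<in> carrier G" using invariant_nontrivial[OF Li L1] .
    \<comment> \<open>The nontrivial \<open>l\<close> is fixed by \<open>Y\<close>, so
      \<open>Y\<close> centralises all of \<open>M\<close>. As \<open>l\<close> is itself in
      \<open>Y\<close>, it is central in \<open>M\<close>.\<close>
    have "fixed_points G M Y = M"
    proof (rule minimal_normal_eqI[OF M _ _ _ l(2)])
      show "invariant_subgroup G (carrier G) (fixed_points G M Y)"
      proof (rule invariant_fixed_points[OF Mi])
        fix h u v assume h: "h \<in> carrier G" and u: "u \<in> Y" and v: "v \<in> fixed_points G M Y"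
        obtain h2 k where k: "h2 \<in> carrier G" "k \<in> L" "u = conjug G h2 k" using u by (auto simp: Y_def)
        then have "conjug G (inv h) u = conjug G (inv h \<otimes> h2) k"
          using h Lc by (simp add: mult_conjug subset_iff)
        then have "conjug G (inv h) u \<in> Y" using h k by (auto simp: Y_def)
        then show "conjug G (conjug G (inv h) u) v = v" using v by (simp add: fixed_points_def)
      qed (use YM Mc in auto)
    qed (use YL LM l in \<open>auto simp: fixed_points_def\<close>)
    then have fixY: "conjug G u v = v" if "u \<in> Y" "v \<in> M" for u v
      using that by (auto simp: fixed_points_def)
    have "l \<in> Y" using l by (auto simp: Y_def intro!: bexI[of _ \<one>] image_eqI[of _ _ l])
    then have "conjug G v l = l" if "v \<in> M" for v
      using that fixY conjug_fix_sym l Mc by blast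
    then have lM: "l \<in> fixed_points G M M" using l LM by (auto simp: fixed_points_def)
    have "fixed_points G M M = M"
    proof (rule minimal_normal_eqI[OF M _ _ lM l(2)])
      show "invariant_subgroup G (carrier G) (fixed_points G M M)"
        by (rule invariant_fixed_points[OF Mi Mc])
          (use Mi in \<open>auto simp: fixed_points_def invariant_subgroup_def\<close>)
    qed (auto simp: fixed_points_def)
    then show ?thesis using x y by (auto simp: fixed_points_def)
  qed
qed

text \<open>Three nested minimal subgroups: \<open>M\<close> under \<open>G\<close>,
  \<open>W\<close> under \<open>K\<close>, and \<open>V\<close> under the displacements of one b in
  \<open>T\<close>. Each such displacement is a product of two commuting self-commuting elements, so
  it has a nontrivial fixed point in \<open>V\<close>; triviality of the action then spreads from
  \<open>V\<close> to \<open>W\<close> and from \<open>W\<close> to \<open>M\<close>.\<close>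

lemma displacement_fixes_minimal_normal:
  assumes M: "minimal_normal M G" and K: "invariant_subgroup G (carrier G) K" "finite K" "M \<subseteq> K"
    and ab: "\<And>x y. \<lbrakk>x \<in> M; y \<in> M\<rbrakk> \<Longrightarrow> x \<otimes> y = y \<otimes> x"
    and T: "T \<subseteq> self_commuting G K" "\<And>g a. \<lbrakk>g \<in> carrier G; a \<in> T\<rbrakk> \<Longrightarrow> conjug G g a \<in> T"
    and a: "a \<in> T" and g: "g \<in> K" and x: "x \<in> M"
  shows "conjug G (displacement G a g) x = x"
proof -
  have Mi: "invariant_subgroup G (carrier G) M"
    using M by (simp add: minimal_normal_def normal_iff_invariant)
  have Ms: "subgroup M G" and Ks: "subgroup K G" using Mi K by (simp_all add: invariant_subgroup_def)
  note Mc = subgroup.subset[OF Ms] and Kc = subgroup.subset[OF Ks]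
  have Tc: "T \<subseteq> carrier G" using T(1) by (auto simp: self_commuting_def)
  have finM: "finite M" using K finite_subset by blast
  have MK: "invariant_subgroup G K M" by (rule invariant_subgroup_mono[OF Mi Kc])
  have "M \<noteq> {\<one>}" using M by (simp add: minimal_normal_def)
  then obtain m where "m \<in> M" "m \<noteq> \<one>" using invariant_nontrivial[OF Mi] by metis
  then obtain W where WM: "W \<subseteq> M" and Wi: "invariant_subgroup G K W" and W1: "W \<noteq> {\<one>}"
    and Wmin: "\<And>V v. \<lbrakk>invariant_subgroup G K V; V \<subseteq> W; v \<in> V; v \<noteq> \<one>\<rbrakk> \<Longrightarrow> V = W"
    using ex_minimal_invariant[OF finM MK] by metis
  obtain w where w: "w \<in> W" "w \<noteq> \<one>" using invariant_nontrivial[OF Wi W1] by metis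
  \<comment> \<open>\<open>W\<close> is chosen before \<open>b\<close>, so the same nontrivial
    \<open>w\<close> is fixed by the displacements of every element of \<open>T\<close>.\<close>
  have Wfix: "fixed_points G W (displacement G b ` K) = W" if b: "b \<in> T" for b
  proof -
    let ?E = "displacement G b ` K"
    have bK: "b \<in> self_commuting G K" and bc: "b \<in> carrier G" using b T(1) Tc by auto
    have bM: "b \<in> self_commuting G M" using bK K(3) by (auto simp: self_commuting_def)
    have EK: "?E \<subseteq> K" using displacement_in_normal[OF K(1) bc] by auto
    have WE: "invariant_subgroup G ?E W" by (rule invariant_subgroup_mono[OF Wi EK])
    obtain V where VW: "V \<subseteq> W" and Vi: "invariant_subgroup G ?E V" and V1: "V \<noteq> {\<one>}"
      and Vmin: "\<And>U u. \<lbrakk>invariant_subgroup G ?E U; U \<subseteq> V; u \<in> U; u \<noteq> \<one>\<rbrakk> \<Longrightarrow> U = V"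
      using ex_minimal_invariant[OF finite_subset[OF WM finM] WE w] by metis
    obtain v where v: "v \<in> V" "v \<noteq> \<one>" using invariant_nontrivial[OF Vi V1] by metis
    have "conjug G e u = u" if e: "e \<in> ?E" and u: "u \<in> V" for e u
    proof -
      obtain k where k: "k \<in> K" "e = displacement G b k" using e by auto
      have kc: "k \<in> carrier G" using k Kc by auto
      have kb: "conjug G k b \<in> self_commuting G M" by (rule conjug_self_commuting[OF bM Mi kc])
      have ib: "inv b \<in> self_commuting G M" by (rule inv_self_commuting[OF bM Mc])
      have "conjug G b (conjug G k b) = conjug G k b"
        using bK k by (simp add: self_commuting_def)
      then have cc: "conjug G (inv b) (conjug G k b) = conjug G k b"
        using bc kc by (simp add: conjug_fix_inv)
      have comm: "conjug G (conjug G k b) (conjug G (inv b) y) = conjug G (inv b) (conjug G (conjug G k b) y)"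
        if "y \<in> M" for y
        using conjug_conjug[of "inv b" "conjug G k b" y] cc bc kc that Mc by (simp add: subset_iff)
      have e': "conjug G k b \<otimes> inv b = e" using k by (simp add: displacement_def)
      have "invariant_subgroup G {conjug G k b \<otimes> inv b} V"
        unfolding e' using e by (intro invariant_subgroup_mono[OF Vi]) auto
      then obtain u0 where u0: "u0 \<in> V" "u0 \<noteq> \<one>" "conjug G e u0 = u0"
        using self_commuting_fixed_point[OF Mi ab kb ib comm _ order_trans[OF VW WM] v] e' by metis
      \<comment> \<open>All displacements of \<open>b\<close> commute with \<open>e\<close>, hence
        preserve its fixed points.\<close>
      have "fixed_points G V {e} = V"
      proof (rule Vmin)
        show "invariant_subgroup G ?E (fixed_points G V {e})"
        proof (rule invariant_fixed_points[OF Vi])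
          fix h y z assume h: "h \<in> ?E" and y: "y \<in> {e}" and z: "z \<in> fixed_points G V {e}"
          have "conjug G h e = e" using h k displacements_commute[OF Ks bK] by auto
          then have "conjug G (inv h) e = e"
            using conjug_fix_inv[of h e] h e EK Kc by blast
          then show "conjug G (conjug G (inv h) y) z = z" using y z by (simp add: fixed_points_def)
        qed (use e EK Kc in auto)
      qed (use u0 in \<open>auto simp: fixed_points_def\<close>)
      then show ?thesis using u by (auto simp: fixed_points_def)
    qed
    then have vE: "v \<in> fixed_points G W ?E" using v VW by (auto simp: fixed_points_def)
    show ?thesis
      by (rule Wmin[OF invariant_fixed_displacements[OF Ks Wi bc] _ vE v(2)]) (auto simp: fixed_points_def)
  qed
  \<comment> \<open>Conjugation by \<open>G\<close> moves \<open>b\<close> within \<open>T\<close>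
    and \<open>k\<close> within \<open>K\<close>, so the union over \<open>T\<close> is stable under
    \<open>G\<close>.\<close>
  let ?D = "\<Union>b\<in>T. displacement G b ` K"
  have "fixed_points G M ?D = M"
  proof (rule minimal_normal_eqI[OF M _ _ _ w(2)])
    show "w \<in> fixed_points G M ?D" using w WM Wfix by (auto simp: fixed_points_def)
    show "invariant_subgroup G (carrier G) (fixed_points G M ?D)"
    proof (rule invariant_fixed_points[OF Mi])
      show "?D \<subseteq> carrier G" using Tc Kc by (auto simp: subset_iff)
      fix h y z assume h: "h \<in> carrier G" and y: "y \<in> ?D" and z: "z \<in> fixed_points G M ?D"
      obtain b k where bk: "b \<in> T" "k \<in> K" "y = displacement G b k" using y by auto
      have "conjug G (inv h) y = displacement G (conjug G (inv h) b) (conjug G (inv h) k)"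
        unfolding bk(3) using bk(1,2) h Tc Kc by (intro displacement_conjug) auto
      moreover have "conjug G (inv h) b \<in> T" using T(2) bk h by simp
      moreover have "conjug G (inv h) k \<in> K" using invariant_subgroupD[OF K(1)] bk h by simp
      ultimately have "conjug G (inv h) y \<in> ?D" by blast
      then show "conjug G (conjug G (inv h) y) z = z" using z by (auto simp: fixed_points_def)
    qed simp
  qed (auto simp: fixed_points_def)
  then have "x \<in> fixed_points G M ?D" using x by simp
  then show ?thesis using a g by (auto simp: fixed_points_def)
qed

section \<open>Lower central series and centrality of minimal normal subgroups\<close>

lemma rel_lower_central_subset:
  assumes "N \<subseteq> carrier G" shows "rel_lower_central G N i \<subseteq> carrier G"
proof (induction i)
  case (Suc i)
  then show ?case
    unfolding rel_lower_central.simps commutator_subgroup_def by (intro generate_incl) auto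
qed (use assms in simp)

lemma commutator_eq_conjug:
  "\<lbrakk>a \<in> carrier G; b \<in> carrier G\<rbrakk> \<Longrightarrow> a \<otimes> b \<otimes> inv a \<otimes> inv b = conjug G a b \<otimes> inv b"
  by (simp add: conjug_def)

text \<open>Commuting modulo the centraliser of \<open>M\<close> is expressed below by the right-hand side, which
  makes no reference to a quotient group.\<close>

lemma commutator_fixes_iff:
  assumes M: "invariant_subgroup G (carrier G) M" and c: "g \<in> carrier G" "h \<in> carrier G"
  shows "(\<forall>x\<in>M. conjug G (conjug G g h \<otimes> inv h) x = x) \<longleftrightarrow>
    (\<forall>x\<in>M. conjug G g (conjug G h x) = conjug G h (conjug G g x))"
proof -
  have Mc: "M \<subseteq> carrier G" using M subgroup.subset by (auto simp: invariant_subgroup_def)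
  have *: "conjug G (conjug G g h \<otimes> inv h) (conjug G h (conjug G g x)) = conjug G g (conjug G h x)"
    if "x \<in> M" for x
    using that c Mc by (simp add: mult_conjug conjug_conjug subset_iff)
  show ?thesis
  proof
    assume "\<forall>x\<in>M. conjug G (conjug G g h \<otimes> inv h) x = x"
    then show "\<forall>x\<in>M. conjug G g (conjug G h x) = conjug G h (conjug G g x)"
      using * invariant_subgroupD[OF M] c by metis
  next
    assume L: "\<forall>x\<in>M. conjug G g (conjug G h x) = conjug G h (conjug G g x)"
    show "\<forall>x\<in>M. conjug G (conjug G g h \<otimes> inv h) x = x"
    proof
      fix x assume x: "x \<in> M"
      let ?y = "conjug G (inv g) (conjug G (inv h) x)"
      have "?y \<in> M" using x c invariant_subgroupD[OF M] by simp
      moreover have "conjug G h (conjug G g ?y) = x" using x c Mc by auto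
      ultimately show "conjug G (conjug G g h \<otimes> inv h) x = x" using *[of ?y] L by simp
    qed
  qed
qed

lemma actions_commute_generate:
  assumes M: "invariant_subgroup G (carrier G) M" and T: "T \<subseteq> carrier G" and h: "h \<in> carrier G"
    and comm: "\<And>a x. \<lbrakk>a \<in> T; x \<in> M\<rbrakk> \<Longrightarrow> conjug G a (conjug G h x) = conjug G h (conjug G a x)"
    and g: "g \<in> generate G T" and x: "x \<in> M"
  shows "conjug G g (conjug G h x) = conjug G h (conjug G g x)"
proof -
  have Mc: "x \<in> carrier G" if "x \<in> M" for x
    using M that subgroup.subset by (auto simp: invariant_subgroup_def)
  show ?thesis
    using g x
  proof (induction arbitrary: x rule: generate.induct)
    case one then show ?case using h Mc by simp
  next
    case (incl a) then show ?case using comm by simp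
  next
    case (inv a)
    have a: "a \<in> carrier G" using inv T by auto
    have "conjug G a (conjug G h (conjug G (inv a) x)) = conjug G h x"
      using comm[OF inv(1), of "conjug G (inv a) x"] invariant_subgroupD[OF M] a inv(2) Mc by simp
    then have "conjug G (inv a) (conjug G h x)
        = conjug G (inv a) (conjug G a (conjug G h (conjug G (inv a) x)))" by simp
    then show ?case using a h inv(2) Mc by simp
  next
    case (eng h1 h2)
    then have "h1 \<in> carrier G" "h2 \<in> carrier G" using generate_in_carrier[OF T] by auto
    then show ?case using eng Mc invariant_subgroupD[OF M] h by (simp add: mult_conjug)
  qed
qed

text \<open>Descending induction: every term of the lower central series from index
  \<open>Suc r\<close> down to \<open>0\<close>, which is \<open>G\<close> itself, centralises
  \<open>M\<close>. The assumption on \<open>r\<close> expresses nilpotency of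
  \<open>G/K\<close>.\<close>

lemma minimal_normal_central:
  assumes M: "minimal_normal M G" and K: "invariant_subgroup G (carrier G) K" "finite K" "M \<subseteq> K"
    and T: "generate G T = carrier G" "T \<subseteq> self_commuting G K"
      "\<And>g a. \<lbrakk>g \<in> carrier G; a \<in> T\<rbrakk> \<Longrightarrow> conjug G g a \<in> T"
    and nil: "lower_central G r \<subseteq> K"
    and g: "g \<in> carrier G" and x: "x \<in> M"
  shows "conjug G g x = x"
proof -
  have Mi: "invariant_subgroup G (carrier G) M"
    using M by (simp add: minimal_normal_def normal_iff_invariant)
  have Ms: "subgroup M G" and Ks: "subgroup K G" using Mi K by (simp_all add: invariant_subgroup_def)
  note Mc = subgroup.subset[OF Ms] and Kc = subgroup.subset[OF Ks]
  have Tc: "T \<subseteq> carrier G" using T(2) by (auto simp: self_commuting_def)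
  have TM: "T \<subseteq> self_commuting G M" using T(2) K(3) by (auto simp: self_commuting_def)
  have ab: "x \<otimes> y = y \<otimes> x" if "x \<in> M" "y \<in> M" for x y
  proof -
    have "conjug G x y = y"
      by (rule minimal_normal_abelian[OF M finite_subset[OF K(3,2)] T(1) TM that])
    then show ?thesis using conjug_eq_iff that Mc by (metis subsetD)
  qed
  have Mnt: "M \<noteq> {\<one>}" using M by (simp add: minimal_normal_def)
  obtain w where w: "w \<in> M" "w \<noteq> \<one>" using invariant_nontrivial[OF Mi Mnt] by metis
  let ?\<Gamma> = "lower_central G"
  have Gc: "?\<Gamma> i \<subseteq> carrier G" for i by (rule rel_lower_central_subset) simp
  \<comment> \<open>\<open>comm\<close> provides a nontrivial fixed point; \<open>z\<close>,
    centrality of the action of \<open>a \<otimes> b\<close>, makes the fixed points normal in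
    \<open>G\<close>.\<close>
  have central_product: "conjug G (a \<otimes> b) y = y"
    if a: "a \<in> self_commuting G M" and b: "b \<in> self_commuting G M"
      and comm: "\<And>x. x \<in> M \<Longrightarrow> conjug G a (conjug G b x) = conjug G b (conjug G a x)"
      and z: "\<And>g x. \<lbrakk>g \<in> carrier G; x \<in> M\<rbrakk> \<Longrightarrow> conjug G g (conjug G (a \<otimes> b) x) = conjug G (a \<otimes> b) (conjug G g x)"
      and y: "y \<in> M" for a b y
  proof -
    have c: "a \<otimes> b \<in> carrier G" using a b by (auto simp: self_commuting_def)
    have "invariant_subgroup G {a \<otimes> b} M" using c by (intro invariant_subgroup_mono[OF Mi]) auto
    then obtain v where v: "v \<in> M" "v \<noteq> \<one>" "conjug G (a \<otimes> b) v = v"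
      using self_commuting_fixed_point[OF Mi ab a b comm _ order_refl w] by metis
    have "fixed_points G M {a \<otimes> b} = M"
    proof (rule minimal_normal_eqI[OF M _ _ _ v(2)])
      show "invariant_subgroup G (carrier G) (fixed_points G M {a \<otimes> b})"
        using Mi subgroup_fixed_points[OF Ms, of "{a \<otimes> b}"] c z
        by (auto simp: invariant_subgroup_def fixed_points_def simp flip: z)
    qed (use v in \<open>auto simp: fixed_points_def\<close>)
    then show ?thesis using y by (auto simp: fixed_points_def)
  qed
  \<comment> \<open>The next term is generated by commutators with all of \<open>G\<close>, but by
    \<open>actions_commute_generate\<close> it suffices to test the elements of
    \<open>T\<close>.\<close>
  have triv_gen: "\<forall>h\<in>?\<Gamma> (Suc i). \<forall>x\<in>M. conjug G h x = x"
    if comm: "\<And>a h x. \<lbrakk>a \<in> T; h \<in> ?\<Gamma> i; x \<in> M\<rbrakk> \<Longrightarrow> conjug G a (conjug G h x) = conjug G h (conjug G a x)" for i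
  proof (intro ballI)
    fix h x assume h: "h \<in> ?\<Gamma> (Suc i)" and x: "x \<in> M"
    let ?S = "{a \<otimes> b \<otimes> inv a \<otimes> inv b | a b. a \<in> carrier G \<and> b \<in> ?\<Gamma> i}"
    show "conjug G h x = x"
    proof (rule generate_fixes[OF _ Mc])
      show "?S \<subseteq> carrier G" using subsetD[OF Gc] by auto
      show "h \<in> generate G ?S" using h by (simp add: commutator_subgroup_def)
      fix s y assume s: "s \<in> ?S" and y: "y \<in> M"
      then obtain a b where ab: "a \<in> carrier G" "b \<in> ?\<Gamma> i" "s = conjug G a b \<otimes> inv b"
        using Gc commutator_eq_conjug by (smt (verit) mem_Collect_eq subsetD)
      have "conjug G a (conjug G b z) = conjug G b (conjug G a z)" if "z \<in> M" for z
        by (rule actions_commute_generate[OF Mi Tc subsetD[OF Gc ab(2)] comm[OF _ ab(2)]])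
          (use ab T(1) that in auto)
      then show "conjug G s y = y" using commutator_fixes_iff[OF Mi, of a b] ab Gc y by auto
    qed (rule x)
  qed
  have triv_comm: "conjug G g (conjug G h x) = conjug G h (conjug G g x)"
    if triv: "\<forall>h\<in>?\<Gamma> (Suc i). \<forall>x\<in>M. conjug G h x = x"
      and g: "g \<in> carrier G" and h: "h \<in> ?\<Gamma> i" and x: "x \<in> M" for g h x i
  proof -
    have hc: "h \<in> carrier G" using h Gc by auto
    have "conjug G g h \<otimes> inv h \<in> ?\<Gamma> (Suc i)"
      unfolding rel_lower_central.simps commutator_subgroup_def
      using g h hc by (intro generate.incl) (auto simp flip: commutator_eq_conjug)
    then show ?thesis using commutator_fixes_iff[OF Mi g hc] triv x by blast
  qed
  \<comment> \<open>At index \<open>r\<close> the element \<open>h\<close> lies in \<open>K\<close>,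
    so its commutator with \<open>a\<close> is a displacement and acts trivially.\<close>
  have top: "\<forall>h\<in>?\<Gamma> (Suc r). \<forall>x\<in>M. conjug G h x = x"
  proof (rule triv_gen)
    fix a h x assume a: "a \<in> T" and h: "h \<in> ?\<Gamma> r" and x: "x \<in> M"
    have ac: "a \<in> carrier G" and hK: "h \<in> K" and hc: "h \<in> carrier G" using a Tc h nil Kc by auto
    have "\<forall>y\<in>M. conjug G (displacement G a h) y = y"
      using displacement_fixes_minimal_normal[OF M K ab T(2,3) a hK] by blast
    then have "\<forall>y\<in>M. conjug G h (conjug G a y) = conjug G a (conjug G h y)"
      using commutator_fixes_iff[OF Mi hc ac] by (simp add: displacement_def)
    then show "conjug G a (conjug G h x) = conjug G h (conjug G a x)" using x by simp
  qed
  have step: "\<forall>h\<in>?\<Gamma> i. \<forall>x\<in>M. conjug G h x = x"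
    if IH: "\<forall>h\<in>?\<Gamma> (Suc i). \<forall>x\<in>M. conjug G h x = x" for i
  proof (cases i)
    case 0
    have "conjug G a y = y" if a: "a \<in> T" and y: "y \<in> M" for a y
    proof -
      have ac: "a \<in> carrier G" using a Tc by auto
      \<comment> \<open>The factor \<one> only brings \<open>a\<close>, whose action is central by
        \<open>IH\<close>, into the form required by \<open>central_product\<close>.\<close>
      have "conjug G (a \<otimes> \<one>) y = y"
      proof (rule central_product[OF _ one_self_commuting[OF Mc] _ _ y])
        show "a \<in> self_commuting G M" using a TM by auto
        show "conjug G a (conjug G \<one> x) = conjug G \<one> (conjug G a x)" if "x \<in> M" for x
          using that ac Mc by (simp add: subset_iff)
        show "conjug G g (conjug G (a \<otimes> \<one>) x) = conjug G (a \<otimes> \<one>) (conjug G g x)"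
          if "g \<in> carrier G" "x \<in> M" for g x
          using triv_comm[OF IH that(1) _ that(2), of a] ac 0 by simp
      qed
      then show ?thesis using ac by simp
    qed
    then show ?thesis using generate_fixes[OF Tc Mc] T(1) 0 by auto
  next
    case (Suc j)
    show ?thesis
      unfolding Suc
    proof (rule triv_gen)
      fix a h x assume a: "a \<in> T" and h: "h \<in> ?\<Gamma> j" and x: "x \<in> M"
      have ac: "a \<in> carrier G" and hc: "h \<in> carrier G" using a Tc h Gc by auto
      \<comment> \<open>The commutator of \<open>a\<close> and \<open>h\<close> is \<open>a\<close>
        times a conjugate of \<open>inv a\<close>, a product of two self-commuting elements.\<close>
      let ?b = "conjug G h (inv a)"
      let ?z = "a \<otimes> ?b"
      have z: "?z = conjug G a h \<otimes> inv h" using ac hc by (simp add: conjug_def m_assoc)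
      have "?z \<in> ?\<Gamma> i"
        unfolding Suc z rel_lower_central.simps commutator_subgroup_def
        using ac h hc by (intro generate.incl) (auto simp flip: commutator_eq_conjug)
      then have zc: "conjug G g (conjug G ?z x) = conjug G ?z (conjug G g x)"
        if "g \<in> carrier G" "x \<in> M" for g x
        using triv_comm[OF IH that(1) _ that(2)] by blast
      have "conjug G ?z y = y" if y: "y \<in> M" for y
      proof (rule central_product[OF _ _ _ zc y])
        show aS: "a \<in> self_commuting G M" using a TM by auto
        show "?b \<in> self_commuting G M"
          by (rule conjug_self_commuting[OF inv_self_commuting[OF aS Mc] Mi hc])
        \<comment> \<open>As \<open>?z = a \<otimes> ?b\<close> acts centrally and
          \<open>?b = inv a \<otimes> ?z\<close>, the actions of \<open>a\<close> and
          \<open>?b\<close> commute.\<close>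
        show "conjug G a (conjug G ?b x) = conjug G ?b (conjug G a x)" if x: "x \<in> M" for x
        proof -
          have "conjug G a (conjug G (inv a) (conjug G ?z x)) = conjug G (inv a) (conjug G ?z (conjug G a x))"
            using zc[OF ac x] ac hc x Mc invariant_subgroupD[OF Mi] by (simp add: subset_iff flip: zc)
          moreover have "?b = inv a \<otimes> ?z" using ac hc by simp
          ultimately show ?thesis using ac hc x Mc mult_conjug[of "inv a" ?z] by (simp add: subset_iff)
        qed
      qed
      then show "conjug G a (conjug G h x) = conjug G h (conjug G a x)"
        using commutator_fixes_iff[OF Mi ac hc] z x by simp
    qed
  qed
  \<comment> \<open>Here \<open>i\<close> counts the steps down from \<open>Suc r\<close>; for
    \<open>i\<close> beyond \<open>r\<close>, truncated subtraction keeps the index at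
    \<open>0\<close>.\<close>
  have "\<forall>h\<in>?\<Gamma> (Suc r - i). \<forall>x\<in>M. conjug G h x = x" for i
  proof (induction i)
    case (Suc i)
    show ?case
    proof (cases "i \<le> r")
      case True
      then have "Suc r - i = Suc (Suc r - Suc i)" by simp
      then show ?thesis using step Suc by metis
    qed (use Suc in simp)
  qed (use top in simp)
  from this[of "Suc r"] show ?thesis using g x by simp
qed

end

section \<open>Images of the lower central series and quotient groups\<close>

lemma (in group_hom) hom_conjug:
  "\<lbrakk>g \<in> carrier G; x \<in> carrier G\<rbrakk> \<Longrightarrow> h (conjug G g x) = conjug H (h g) (h x)"
  by (simp add: conjug_def)

lemma (in group_hom) hom_rel_lower_central:
  assumes surj: "h ` carrier G = carrier H" and N: "N \<subseteq> carrier G"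
  shows "h ` rel_lower_central G N i = rel_lower_central H (h ` N) i"
proof (induction i)
  case (Suc i)
  have L: "x \<in> carrier G" if "x \<in> rel_lower_central G N i" for x
    using that G.rel_lower_central_subset[OF N] by auto
  let ?S = "{a \<otimes> b \<otimes> inv a \<otimes> inv b | a b. a \<in> carrier G \<and> b \<in> rel_lower_central G N i}"
  let ?S' = "{a \<otimes>\<^bsub>H\<^esub> b \<otimes>\<^bsub>H\<^esub> inv\<^bsub>H\<^esub> a \<otimes>\<^bsub>H\<^esub> inv\<^bsub>H\<^esub> b | a b.
      a \<in> carrier H \<and> b \<in> rel_lower_central H (h ` N) i}"
  have hom: "h (a \<otimes> b \<otimes> inv a \<otimes> inv b) = h a \<otimes>\<^bsub>H\<^esub> h b \<otimes>\<^bsub>H\<^esub> inv\<^bsub>H\<^esub> h a \<otimes>\<^bsub>H\<^esub> inv\<^bsub>H\<^esub> h b"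
    if "a \<in> carrier G" "b \<in> carrier G" for a b using that by simp
  have "h ` ?S = ?S'"
  proof (intro equalityI subsetI)
    fix y assume "y \<in> h ` ?S"
    then obtain a b where ab: "a \<in> carrier G" "b \<in> rel_lower_central G N i"
      "y = h (a \<otimes> b \<otimes> inv a \<otimes> inv b)" by blast
    then have "h a \<in> carrier H" "h b \<in> rel_lower_central H (h ` N) i" using Suc by auto
    then show "y \<in> ?S'" unfolding ab(3) hom[OF ab(1) L[OF ab(2)]] by blast
  next
    fix y assume "y \<in> ?S'"
    then obtain a b where ab: "a \<in> carrier H" "b \<in> rel_lower_central H (h ` N) i"
      "y = a \<otimes>\<^bsub>H\<^esub> b \<otimes>\<^bsub>H\<^esub> inv\<^bsub>H\<^esub> a \<otimes>\<^bsub>H\<^esub> inv\<^bsub>H\<^esub> b" by blast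
    obtain a' b' where ab': "a' \<in> carrier G" "a = h a'" "b' \<in> rel_lower_central G N i" "b = h b'"
      using ab(1,2) unfolding surj[symmetric] Suc[symmetric] by blast
    have "y = h (a' \<otimes> b' \<otimes> inv a' \<otimes> inv b')"
      unfolding ab(3) ab'(2,4) using hom[OF ab'(1) L[OF ab'(3)]] by simp
    then show "y \<in> h ` ?S" using ab' by blast
  qed
  moreover have "?S \<subseteq> carrier G" using L by auto
  then have "generate H (h ` ?S) = h ` generate G ?S" by (rule generate_img)
  ultimately show ?case
    unfolding rel_lower_central.simps commutator_subgroup_def by simp
qed simp

context group
begin

lemma rel_lower_central_mono:
  assumes "N \<subseteq> K"
  shows "rel_lower_central G N i \<subseteq> rel_lower_central G K i"
proof (induction i)
  case (Suc i)
  then show ?case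
    unfolding rel_lower_central.simps commutator_subgroup_def by (intro mono_generate) blast
qed (use assms in simp)

text \<open>Restarting the series at its own \<open>j\<close>-th term lets the \<open>r\<close>
  steps coming from \<open>Q\<close> and the \<open>m\<close> steps inside the kernel add
  up.\<close>

lemma rel_lower_central_add:
  "rel_lower_central G N (i + j) = rel_lower_central G (rel_lower_central G N j) i"
  by (induction i) simp_all

lemma one_in_rel_lower_central:
  assumes "\<one> \<in> N"
  shows "\<one> \<in> rel_lower_central G N i"
  using assms by (cases i) (simp_all add: commutator_subgroup_def generate.one)

text \<open>Rewrites the factors in \<open>chief_series\<close> as images under the quotient map of
  \<open>G\<close>, to which homomorphism lemmas apply.\<close>

lemma carrier_FactGroup_restrict:
  "carrier (G\<lparr>carrier := K\<rparr> Mod N) = (\<lambda>x. N #> x) ` K"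
  by (auto simp: FactGroup_def RCOSETS_def r_coset_def)

lemma group_hom_Mod:
  assumes "N \<lhd> G"
  shows "group_hom G (G Mod N) (\<lambda>x. N #> x)"
  using assms normal.r_coset_hom_Mod normal.factorgroup_is_group
  by (auto simp: group_hom_def group_hom_axioms_def)

lemma r_coset_eq_one_Mod_iff:
  assumes N: "N \<lhd> G" and x: "x \<in> carrier G"
  shows "N #> x = \<one>\<^bsub>G Mod N\<^esub> \<longleftrightarrow> x \<in> N"
proof -
  have s: "subgroup N G" by (rule normal_imp_subgroup[OF N])
  have "\<one>\<^bsub>G Mod N\<^esub> = N" by (simp add: FactGroup_def)
  then show ?thesis using subgroup.rcos_const[OF s] rcos_self[OF x s] is_group by auto
qed

lemma carrier_Mod: "carrier (G Mod N) = (\<lambda>x. N #> x) ` carrier G"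
  by (auto simp: FactGroup_def RCOSETS_def)

lemma invariant_subgroup_Mod_image:
  assumes N: "N \<lhd> G" and K: "invariant_subgroup G (carrier G) K"
  shows "invariant_subgroup (G Mod N) (carrier (G Mod N)) ((\<lambda>x. N #> x) ` K)"
proof -
  interpret q: group_hom G "G Mod N" "\<lambda>x. N #> x" by (rule group_hom_Mod[OF N])
  have Ks: "subgroup K G" using K by (simp add: invariant_subgroup_def)
  show ?thesis
    unfolding invariant_subgroup_def
  proof (intro conjI ballI)
    show "subgroup ((\<lambda>x. N #> x) ` K) (G Mod N)" by (rule q.subgroup_img_is_subgroup[OF Ks])
    fix u v assume "u \<in> carrier (G Mod N)" "v \<in> (\<lambda>x. N #> x) ` K"
    then obtain g k where "g \<in> carrier G" "u = N #> g" "k \<in> K" "v = N #> k"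
      by (auto simp: carrier_Mod)
    then show "conjug (G Mod N) u v \<in> (\<lambda>x. N #> x) ` K"
      using invariant_subgroupD[OF K] subgroup.subset[OF Ks] by (auto simp flip: q.hom_conjug)
  qed
qed

section \<open>Chief series: existence and central factors\<close>

lemma chief_series_mono:
  assumes S: "chief_series G N m S" and "i \<le> j" "j \<le> m"
  shows "S i \<subseteq> S j"
  using assms(2,3)
proof (induction j rule: dec_induct)
  case (step j)
  then have "S j \<subset> S (Suc j)" using S by (auto simp: chief_series_def)
  then show ?case using step by auto
qed simp

text \<open>Induction on the order: put \<open>N\<close> on top of a chief series of some
  \<open>L\<close>, maximal among the normal subgroups of \<open>G\<close> properly inside
  \<open>N\<close>.\<close>

lemma ex_chief_series:
  assumes "finite N" "N \<lhd> G"
  shows "\<exists>m S. chief_series G N m S"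
  using assms
proof (induction "card N" arbitrary: N rule: less_induct)
  case less
  note N = \<open>N \<lhd> G\<close> and fin = \<open>finite N\<close>
  have Ni: "invariant_subgroup G (carrier G) N" using N by (simp add: normal_iff_invariant)
  have Ns: "subgroup N G" by (rule normal_imp_subgroup[OF N])
  show ?case
  proof (cases "N = {\<one>}")
    case True
    then have "chief_series G N 0 (\<lambda>_. N)" using N by (simp add: chief_series_def)
    then show ?thesis by blast
  next
    case False
    let ?A = "{L. L \<lhd> G \<and> L \<subset> N}"
    have "finite ?A" using fin by (auto intro: finite_subset[of _ "Pow N"])
    moreover have "{\<one>} \<in> ?A"
      using False subgroup.one_closed[OF Ns] one_is_normal by auto
    ultimately obtain L where L: "L \<in> ?A" and max: "\<And>J. J \<in> ?A \<Longrightarrow> L \<subseteq> J \<Longrightarrow> L = J"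
      using finite_has_maximal[of ?A] by auto
    have LG: "L \<lhd> G" and LN: "L \<subset> N" using L by auto
    obtain m S where S: "chief_series G L m S"
      using less(1)[OF psubset_card_mono[OF fin LN] finite_subset[OF _ fin] LG] LN by auto
    interpret q: group_hom G "G Mod L" "\<lambda>x. L #> x" by (rule group_hom_Mod[OF LG])
    have Ls: "subgroup L G" by (rule normal_imp_subgroup[OF LG])
    have Nc: "x \<in> carrier G" if "x \<in> N" for x using that subgroup.subset[OF Ns] by auto
    have "minimal_normal ((\<lambda>x. L #> x) ` N) (G Mod L)"
      unfolding minimal_normal_def
    proof (intro conjI allI impI)
      show "(\<lambda>x. L #> x) ` N \<lhd> G Mod L"
        using invariant_subgroup_Mod_image[OF LG Ni] by (simp add: q.H.normal_iff_invariant)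
      obtain x where "x \<in> N" "x \<notin> L" using LN by auto
      then show "(\<lambda>x. L #> x) ` N \<noteq> {\<one>\<^bsub>G Mod L\<^esub>}"
        using r_coset_eq_one_Mod_iff[OF LG, of x] Nc by blast
      fix J assume J: "J \<lhd> G Mod L" and JN: "J \<subseteq> (\<lambda>x. L #> x) ` N"
      have Js: "subgroup J (G Mod L)" by (rule normal_imp_subgroup[OF J])
      have Ji: "invariant_subgroup (G Mod L) (carrier (G Mod L)) J"
        using J by (simp add: q.H.normal_iff_invariant)
      \<comment> \<open>The preimage of \<open>J\<close> in \<open>N\<close> lies between
        \<open>L\<close> and \<open>N\<close>, so maximality of \<open>L\<close> leaves only these
        two cases.\<close>
      let ?J = "{x \<in> N. L #> x \<in> J}"
      have "invariant_subgroup G (carrier G) ?J"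
        unfolding invariant_subgroup_def
      proof (intro conjI ballI)
        show "subgroup ?J G"
        proof
          show "?J \<subseteq> carrier G" using Nc by auto
          show "\<one> \<in> ?J"
            using subgroup.one_closed[OF Ns] subgroup.one_closed[OF Js] q.hom_one by simp
          show "x \<otimes> y \<in> ?J" if "x \<in> ?J" "y \<in> ?J" for x y
            using that subgroup.m_closed[OF Ns] subgroup.m_closed[OF Js] q.hom_mult Nc by simp
          show "inv x \<in> ?J" if "x \<in> ?J" for x
            using that subgroup.m_inv_closed[OF Ns] subgroup.m_inv_closed[OF Js] q.hom_inv Nc by simp
        qed
        show "conjug G g x \<in> ?J" if "g \<in> carrier G" "x \<in> ?J" for g x
          using that invariant_subgroupD[OF Ni] q.H.invariant_subgroupD[OF Ji] q.hom_conjug Nc by simp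
      qed
      then have JG: "?J \<lhd> G" by (simp add: normal_iff_invariant)
      have LJ: "L \<subseteq> ?J"
      proof
        fix l assume l: "l \<in> L"
        then have "l \<in> N" using LN by auto
        moreover have "L #> l = \<one>\<^bsub>G Mod L\<^esub>"
          using r_coset_eq_one_Mod_iff[OF LG Nc[OF \<open>l \<in> N\<close>]] l by blast
        ultimately show "l \<in> ?J" using subgroup.one_closed[OF Js] by (metis mem_Collect_eq)
      qed
      show "J = {\<one>\<^bsub>G Mod L\<^esub>} \<or> J = (\<lambda>x. L #> x) ` N"
      proof (cases "?J = N")
        case True
        then show ?thesis using JN by blast
      next
        case False
        then have "L = ?J" using max[OF _ LJ] JG by auto
        then have "y = \<one>\<^bsub>G Mod L\<^esub>" if "y \<in> J" for y
          using that JN r_coset_eq_one_Mod_iff[OF LG] Nc by blast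
        then show ?thesis using subgroup.one_closed[OF Js] by blast
      qed
    qed
    then have min: "minimal_normal (carrier (G\<lparr>carrier := N\<rparr> Mod L)) (G Mod L)"
      unfolding carrier_FactGroup_restrict .
    have "chief_series G N (Suc m) (\<lambda>i. if i \<le> m then S i else N)"
      unfolding chief_series_def
    proof (intro conjI allI impI)
      fix i assume i: "i < Suc m"
      have "S m = L" using S by (simp add: chief_series_def)
      then show "(if i \<le> m then S i else N) \<subset> (if Suc i \<le> m then S (Suc i) else N)"
        "minimal_normal (carrier (G\<lparr>carrier := if Suc i \<le> m then S (Suc i) else N\<rparr> Mod
            (if i \<le> m then S i else N))) (G Mod (if i \<le> m then S i else N))"
        using S LN min i by (cases "i = m"; simp add: chief_series_def)+
    qed (use S N in \<open>auto simp: chief_series_def\<close>)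
    then show ?thesis by blast
  qed
qed

text \<open>All assumptions pass to the quotient by \<open>S i\<close>, where the image of
  \<open>S (Suc i)\<close> is minimal normal and \<open>minimal_normal_central\<close>
  applies.\<close>

lemma chief_series_central:
  assumes S: "chief_series G K m S" and fin: "finite K"
    and T: "generate G T = carrier G" "T \<subseteq> self_commuting G K"
      "\<And>g a. \<lbrakk>g \<in> carrier G; a \<in> T\<rbrakk> \<Longrightarrow> conjug G g a \<in> T"
    and nil: "lower_central G r \<subseteq> K"
    and i: "i < m" and g: "g \<in> carrier G" and x: "x \<in> S (Suc i)"
  shows "g \<otimes> x \<otimes> inv g \<otimes> inv x \<in> S i"
proof -
  have Km: "S m = K" and N: "S i \<lhd> G" and N': "S (Suc i) \<lhd> G" and K: "K \<lhd> G"
    using S i unfolding chief_series_def by auto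
  have Ki: "invariant_subgroup G (carrier G) K" using K by (simp add: normal_iff_invariant)
  have Kc: "k \<in> carrier G" if "k \<in> K" for k
    using that subgroup.subset[OF normal_imp_subgroup[OF K]] by auto
  have Tc: "a \<in> carrier G" if "a \<in> T" for a using T(2) that by (auto simp: self_commuting_def)
  let ?q = "\<lambda>x. S i #> x"
  interpret q: group_hom G "G Mod S i" ?q by (rule group_hom_Mod[OF N])
  have SK: "S (Suc i) \<subseteq> K" using chief_series_mono[OF S, of "Suc i" m] i Km by simp
  have xc: "x \<in> carrier G" using x SK Kc by auto
  have "conjug (G Mod S i) (?q g) (?q x) = ?q x"
  proof (rule q.H.minimal_normal_central)
    show "minimal_normal (?q ` S (Suc i)) (G Mod S i)"
      using S i unfolding chief_series_def carrier_FactGroup_restrict by auto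
    show "invariant_subgroup (G Mod S i) (carrier (G Mod S i)) (?q ` K)"
      by (rule invariant_subgroup_Mod_image[OF N Ki])
    show "finite (?q ` K)" using fin by simp
    show "?q ` S (Suc i) \<subseteq> ?q ` K" using SK by blast
    have "generate (G Mod S i) (?q ` T) = ?q ` generate G T"
      by (rule q.generate_img) (use Tc in auto)
    then show "generate (G Mod S i) (?q ` T) = carrier (G Mod S i)"
      using T(1) by (simp add: carrier_Mod)
    show "?q ` T \<subseteq> self_commuting (G Mod S i) (?q ` K)"
      using T(2) Tc Kc by (auto simp: self_commuting_def simp flip: q.hom_conjug)
    show "conjug (G Mod S i) u v \<in> ?q ` T" if "u \<in> carrier (G Mod S i)" "v \<in> ?q ` T" for u v
      using that T(3) Tc by (auto simp: carrier_Mod simp flip: q.hom_conjug)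
    have "lower_central (G Mod S i) r = ?q ` lower_central G r"
      using q.hom_rel_lower_central[of "carrier G" r] by (simp add: carrier_Mod)
    then show "lower_central (G Mod S i) r \<subseteq> ?q ` K" using nil by auto
  qed (use g x in auto)
  then have "?q (conjug G g x) = ?q x" using g xc by (simp add: q.hom_conjug)
  then have "?q (conjug G g x) \<otimes>\<^bsub>G Mod S i\<^esub> inv\<^bsub>G Mod S i\<^esub> ?q x = \<one>\<^bsub>G Mod S i\<^esub>"
    using q.H.r_inv[OF q.hom_closed[OF xc]] by simp
  then have "?q (conjug G g x \<otimes> inv x) = \<one>\<^bsub>G Mod S i\<^esub>"
    using g xc by (metis q.hom_mult q.hom_inv conjug_closed inv_closed)
  moreover have "conjug G g x \<otimes> inv x \<in> carrier G" using g xc by simp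
  ultimately have "conjug G g x \<otimes> inv x \<in> S i" using r_coset_eq_one_Mod_iff[OF N] by blast
  then show ?thesis using g xc by (simp add: commutator_eq_conjug)
qed

text \<open>Each commutator with \<open>G\<close> descends one step, so the \<open>j\<close>-th
  relative term lies in \<open>S (m - j)\<close>.\<close>

lemma chief_series_rel_lower_central:
  assumes S: "chief_series G K m S"
    and central: "\<And>i g x. \<lbrakk>i < m; g \<in> carrier G; x \<in> S (Suc i)\<rbrakk> \<Longrightarrow> g \<otimes> x \<otimes> inv g \<otimes> inv x \<in> S i"
  shows "rel_lower_central G K m = {\<one>}"
proof -
  have "j \<le> m \<Longrightarrow> rel_lower_central G K j \<subseteq> S (m - j)" for j
  proof (induction j)
    case 0
    then show ?case using S by (simp add: chief_series_def)
  next
    case (Suc j)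
    have e: "m - j = Suc (m - Suc j)" using Suc by simp
    have "S (m - Suc j) \<lhd> G" using S by (simp add: chief_series_def)
    then show ?case
      unfolding rel_lower_central.simps commutator_subgroup_def
    proof (intro generate_subgroup_incl[OF _ normal_imp_subgroup] subsetI)
      fix y assume "y \<in> {a \<otimes> b \<otimes> inv a \<otimes> inv b | a b. a \<in> carrier G \<and> b \<in> rel_lower_central G K j}"
      then obtain a b where ab: "a \<in> carrier G" "b \<in> rel_lower_central G K j"
        "y = a \<otimes> b \<otimes> inv a \<otimes> inv b" by blast
      then show "y \<in> S (m - Suc j)" using central[of "m - Suc j" a b] Suc e by auto
    qed
  qed
  from this[of m] have "rel_lower_central G K m \<subseteq> {\<one>}" using S by (simp add: chief_series_def)
  moreover have "K \<lhd> G" using S unfolding chief_series_def by auto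
  then have "\<one> \<in> K" by (rule subgroup.one_closed[OF normal_imp_subgroup])
  then have "\<one> \<in> rel_lower_central G K m" by (rule one_in_rel_lower_central)
  ultimately show ?thesis by blast
qed

end

section \<open>Application to inner automorphism groups of quandles\<close>

lemma (in quandle) conjug_symm:
  assumes g: "g \<in> carrier (Inn Q)" and x: "x \<in> carrier Q"
  shows "g x \<in> carrier Q" "conjug (Inn Q) g (symm Q x) = symm Q (g x)"
proof -
  interpret I: group "Inn Q" by (rule group_Inn)
  have gA: "g \<in> quandle_hom Q Q" "g \<in> Bij (carrier Q)"
    using g group.carrier_subgroup_generated_subset[OF group_quandle_Aut]
    by (auto simp: Inn_def carrier_quandle_Aut)
  then have gc: "g y \<in> carrier Q" if "y \<in> carrier Q" for y
    using that by (auto simp: quandle_hom_def)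
  show gx: "g x \<in> carrier Q" by (rule gc[OF x])
  have sc: "qsym Q x y \<in> carrier Q" if "y \<in> carrier Q" for y
    using sym_bij[OF x] that by (auto simp: bij_betw_def)
  have "g \<otimes>\<^bsub>Inn Q\<^esub> symm Q x = symm Q (g x) \<otimes>\<^bsub>Inn Q\<^esub> g"
    unfolding mult_Inn[OF g symm_in_Inn[OF x]] mult_Inn[OF symm_in_Inn[OF gx] g]
    using gA(1) gc x sc by (auto simp: compose_def symm_def quandle_hom_def fun_eq_iff)
  then show "conjug (Inn Q) g (symm Q x) = symm Q (g x)"
    using I.conjug_eq_iff g symm_in_Inn x gx by simp
qed

theorem theorem4p16:
  fixes P :: "('a, 'm) quandle_struct_scheme"
    and Q :: "('b, 'n) quandle_struct_scheme"
    and f :: "'a \<Rightarrow> 'b"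
  assumes "quandle P" and "quandle Q"
    and "operator_reduced P Q f"
    and "finite (Inn_rel P Q f)"
  shows "(nilpotent Q \<longrightarrow> nilpotent_epi P Q f \<and> nilpotent P) \<and>
    (\<forall>r m. c_nilpotent r Q \<and> (\<exists>S. chief_series (Inn P) (Inn_rel P Q f) m S) \<longrightarrow>
      c_nilpotent_epi m P Q f \<and> c_nilpotent (m + r) P)"
proof -
  interpret P: quandle P by fact
  interpret Q: quandle Q by fact
  have f: "f \<in> quandle_epi P Q" using assms(3) by (simp add: operator_reduced_def)
  let ?G = "Inn P" and ?K = "Inn_rel P Q f" and ?h = "Inn_map P Q f" and ?T = "symm P ` carrier P"
  interpret G: group ?G by (rule P.group_Inn)
  have "is_Inn_map P Q f ?h"
    unfolding Inn_map_def by (rule theI'[OF ex1_Inn_map[OF assms(1,2) f]])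
  then have epi: "?h \<in> epi ?G (Inn Q)" by (simp add: is_Inn_map_def)
  interpret h: group_hom ?G "Inn Q" ?h
    using epi Q.group_Inn G.is_group by (simp add: group_hom_def group_hom_axioms_def epi_def)
  have surj: "?h ` carrier ?G = carrier (Inn Q)" using epi by (simp add: epi_def)
  have K: "?K \<lhd> ?G" unfolding Inn_rel_def by (rule h.normal_kernel)
  have Kc: "k \<in> carrier ?G" if "k \<in> ?K" for k
    using that subgroup.subset[OF normal_imp_subgroup[OF K]] by auto
  have T1: "generate ?G ?T = carrier ?G" using P.carrier_Inn_generate by simp
  \<comment> \<open>Operator-reducedness speaks of \<open>symm P (k x)\<close>, which by
    \<open>conjug_symm\<close> is the conjugate of \<open>symm P x\<close> by
    \<open>k\<close>.\<close>
  have T2: "?T \<subseteq> self_commuting ?G ?K"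
  proof
    fix a assume "a \<in> ?T"
    then obtain x where x: "x \<in> carrier P" "a = symm P x" by auto
    have "conjug ?G a (conjug ?G k a) = conjug ?G k a" if k: "k \<in> ?K" for k
    proof -
      have "a \<otimes>\<^bsub>?G\<^esub> symm P (k x) = symm P (k x) \<otimes>\<^bsub>?G\<^esub> a"
        using assms(3) x k by (simp add: operator_reduced_def)
      then show ?thesis
        using P.conjug_symm[OF Kc[OF k] x(1)] P.symm_in_Inn x by (simp add: G.conjug_eq_iff)
    qed
    then show "a \<in> self_commuting ?G ?K" using P.symm_in_Inn x by (simp add: self_commuting_def)
  qed
  have T3: "conjug ?G g a \<in> ?T" if "g \<in> carrier ?G" "a \<in> ?T" for g a
    using that P.conjug_symm by auto
  have main: "c_nilpotent_epi m P Q f \<and> c_nilpotent (m + r) P"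
    if r: "c_nilpotent r Q" and S: "chief_series ?G ?K m S" for r m S
  proof -
    \<comment> \<open>Since \<open>Q\<close> is \<open>r\<close>-nilpotent, \<open>?h\<close> kills
      the \<open>r\<close>-th term for \<open>?G\<close>, which therefore lies in the kernel
      \<open>?K\<close>.\<close>
    have "?h ` lower_central ?G r = {\<one>\<^bsub>Inn Q\<^esub>}"
      using h.hom_rel_lower_central[OF surj, of "carrier ?G" r] r surj by (simp add: c_nilpotent_def)
    then have nil: "lower_central ?G r \<subseteq> ?K"
      using G.rel_lower_central_subset[of "carrier ?G" r] by (auto simp: Inn_rel_def kernel_def)
    have 1: "rel_lower_central ?G ?K m = {\<one>\<^bsub>?G\<^esub>}"
      by (rule G.chief_series_rel_lower_central[OF S G.chief_series_central[OF S assms(4) T1 T2 T3 nil]])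
    have "lower_central ?G (m + r) \<subseteq> {\<one>\<^bsub>?G\<^esub>}"
      using G.rel_lower_central_mono[OF nil, of m] 1 by (simp add: G.rel_lower_central_add)
    then have "lower_central ?G (m + r) = {\<one>\<^bsub>?G\<^esub>}"
      using G.one_in_rel_lower_central[of "carrier ?G" "m + r"] by auto
    then show ?thesis using 1 f by (simp add: c_nilpotent_epi_def c_nilpotent_def)
  qed
  \<comment> \<open>Finiteness of \<open>?K\<close> supplies some chief series, so the quantitative
    claim implies the qualitative one.\<close>
  moreover obtain m S where "chief_series ?G ?K m S" using G.ex_chief_series[OF assms(4) K] by blast
  ultimately show ?thesis unfolding nilpotent_def nilpotent_epi_def by blast
qed

end
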